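(* Let $m\ge2$. The maps $p\mapsto\mathfrak{F}_p$ and $p\mapsto\mathfrak{F}^{\mathrm{convex}}_p$ are left-continuous on $(1,\infty]$; in particular $\lim_{p\uparrow\infty}\mathfrak{F}_p=\mathfrak{F}_\infty$.
   Context: For a non-empty open $\Omega\subset\mathbb{R}^m$ with $|\Omega|<\infty$, $\lambda_1(\Omega)=\inf_{\varphi\in H_0^1(\Omega)\setminus\{0\}}\int_\Omega|D\varphi|^2/\int_\Omega\varphi^2$, $v_\Omega$ is the unique solution of $-\Delta v=1$, $v\in H_0^1(\Omega)$, $F_p(\Omega)=\|v_\Omega\|_{L^p(\Omega)}\lambda_1(\Omega)/|\Omega|^{1/p}$ for $1\le p<\infty$, and $F_\infty(\Omega)=\|v_\Omega\|_{L^\infty(\Omega)}\lambda_1(\Omega)$. For $1\le p\le\infty$: $\mathfrak{F}_p=\sup\{F_p(\Omega):\Omega\text{ open in }\mathbb{R}^m,\ 0<|\Omega|<\infty\}$ and $\mathfrak{F}^{\mathrm{convex}}_p=\sup\{F_p(\Omega):\Omega\text{ open, convex in }\mathbb{R}^m,\ 0<|\Omega|<\infty\}$. *)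

theory Defs
  imports "HOL-Analysis.Analysis" "HOL-Probability.Essential_Supremum"
begin

coinductive smooth_fun :: "('a::euclidean_space \<Rightarrow> real) \<Rightarrow> bool" where
  "\<lbrakk> f differentiable_on UNIV; continuous_on UNIV f;
     \<forall>b\<in>Basis. smooth_fun (\<lambda>x. frechet_derivative f (at x) b) \<rbrakk> \<Longrightarrow> smooth_fun f"

definition grad :: "('a::euclidean_space \<Rightarrow> real) \<Rightarrow> 'a \<Rightarrow> 'a" where
  "grad f x = (\<Sum>b\<in>Basis. frechet_derivative f (at x) b *\<^sub>R b)"

definition test_fun :: "'a::euclidean_space set \<Rightarrow> ('a \<Rightarrow> real) \<Rightarrow> bool" where
  "test_fun \<Omega> \<phi> \<longleftrightarrow> smooth_fun \<phi> \<and> compact (closure {x. \<phi> x \<noteq> 0})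
      \<and> closure {x. \<phi> x \<noteq> 0} \<subseteq> \<Omega>"

text \<open>\<open>H01 \<Omega> u G\<close>: u belongs to H_0^1(\<Omega>) with (weak) gradient G, i.e. there are test functions
  \<phi>_k with \<phi>_k \<rightarrow> u and D\<phi>_k \<rightarrow> G in L^2(\<Omega>).\<close>
definition H01 :: "'a::euclidean_space set \<Rightarrow> ('a \<Rightarrow> real) \<Rightarrow> ('a \<Rightarrow> 'a) \<Rightarrow> bool" where
  "H01 \<Omega> u G \<longleftrightarrow> u \<in> borel_measurable lebesgue \<and> G \<in> borel_measurable lebesgue \<and>
     (\<exists>\<phi>::nat \<Rightarrow> 'a \<Rightarrow> real. (\<forall>k. test_fun \<Omega> (\<phi> k)) \<and>
        ((\<lambda>k. \<integral>\<^sup>+ x\<in>\<Omega>. ennreal ((u x - \<phi> k x)\<^sup>2) \<partial>lebesgue) \<longlonglongrightarrow> 0) \<and>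
        ((\<lambda>k. \<integral>\<^sup>+ x\<in>\<Omega>. ennreal ((norm (G x - grad (\<phi> k) x))\<^sup>2) \<partial>lebesgue) \<longlonglongrightarrow> 0))"

definition lambda1 :: "'a::euclidean_space set \<Rightarrow> real" where
  "lambda1 \<Omega> = Inf {(LINT x:\<Omega>|lebesgue. (norm (G x))\<^sup>2) / (LINT x:\<Omega>|lebesgue. (u x)\<^sup>2) | u G.
      H01 \<Omega> u G \<and> (LINT x:\<Omega>|lebesgue. (u x)\<^sup>2) \<noteq> 0}"

text \<open>The torsion function: the (a.e. unique) weak solution v \<in> H_0^1(\<Omega>) of -\<Delta>v = 1.\<close>
definition torsion :: "'a::euclidean_space set \<Rightarrow> 'a \<Rightarrow> real" where
  "torsion \<Omega> = (SOME v. \<exists>G. H01 \<Omega> v G \<and>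
      (\<forall>\<phi>. test_fun \<Omega> \<phi> \<longrightarrow>
         (LINT x:\<Omega>|lebesgue. G x \<bullet> grad \<phi> x) = (LINT x:\<Omega>|lebesgue. \<phi> x)))"

definition Lp_norm :: "real \<Rightarrow> 'a::euclidean_space set \<Rightarrow> ('a \<Rightarrow> real) \<Rightarrow> real" where
  "Lp_norm p \<Omega> v = (LINT x:\<Omega>|lebesgue. \<bar>v x\<bar> powr p) powr (1 / p)"

definition Linf_norm :: "'a::euclidean_space set \<Rightarrow> ('a \<Rightarrow> real) \<Rightarrow> real" where
  "Linf_norm \<Omega> v = real_of_ereal (esssup lebesgue (\<lambda>x. ereal (indicator \<Omega> x * \<bar>v x\<bar>)))"

definition Ffun :: "ereal \<Rightarrow> 'a::euclidean_space set \<Rightarrow> real" where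
  "Ffun p \<Omega> = (if p = \<infinity> then Linf_norm \<Omega> (torsion \<Omega>) * lambda1 \<Omega>
     else Lp_norm (real_of_ereal p) \<Omega> (torsion \<Omega>) * lambda1 \<Omega>
            / measure lebesgue \<Omega> powr (1 / real_of_ereal p))"

definition Frak :: "'a::euclidean_space itself \<Rightarrow> ereal \<Rightarrow> ereal" where
  "Frak _ p = (SUP \<Omega>\<in>{\<Omega>::'a set. open \<Omega> \<and> 0 < emeasure lebesgue \<Omega> \<and> emeasure lebesgue \<Omega> < \<infinity>}.
                 ereal (Ffun p \<Omega>))"

definition Frak_convex :: "'a::euclidean_space itself \<Rightarrow> ereal \<Rightarrow> ereal" where
  "Frak_convex _ p = (SUP \<Omega>\<in>{\<Omega>::'a set. open \<Omega> \<and> convex \<Omega> \<and> 0 < emeasure lebesgue \<Omega>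
                 \<and> emeasure lebesgue \<Omega> < \<infinity>}. ereal (Ffun p \<Omega>))"

end

theory Submission
  imports Defs
begin

text \<open>
  For a fixed set the factor of \<open>F\<^sub>p\<close> depending on \<open>p\<close> is the \<open>L\<^sup>p\<close> norm of the torsion function
  with respect to normalised Lebesgue measure. It is nondecreasing and left-continuous in \<open>p\<close>
  (up to and including \<open>p = \<infinity>\<close>) as soon as the torsion function is bounded, and a supremum of
  nondecreasing left-continuous functions is again left-continuous.

  Existence and boundedness of the torsion function on an arbitrary open set of finite measure both
  rest on the Nash type inequality
  \<open>\<integral> f\<^sup>2 \<le> (\<integral> \<bar>f\<bar>)\<^sup>2 / \<bar>B\<^sub>R\<bar> + R\<^sup>2/2 \<integral> \<bar>Df\<bar>\<^sup>2\<close>, obtained by averaging the squared increments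
  \<open>(f(x+h) - f(x))\<^sup>2\<close> over the ball \<open>B\<^sub>R\<close>. Taking \<open>\<bar>B\<^sub>R\<bar> = 2 \<bar>\<Omega>\<bar>\<close> it gives the Poincare inequality, hence
  a convergent minimising sequence of test functions for the torsion energy. Applied to truncations
  \<open>(v - k)\<^sup>+\<close> of a solution it shows that raising the level \<open>k\<close> by \<open>C b\<^sup>2\<^sup>/\<^sup>m\<close> halves the bound \<open>b\<close> on the
  measure of \<open>{v > k}\<close>; since these increments form a geometric series, \<open>v\<close> is bounded.
\<close>

section \<open>Smooth functions and test functions\<close>

text \<open>\<open>torsion\<close> is a choice among functions, and nothing is known about the
  chosen one until some weak solution is exhibited; hence existence has to be proved, and
  boundedness is shown for every weak solution. The averaging argument uses only the fundamental
  theorem of calculus on segments, Fubini and translation invariance. It therefore treats all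
  dimensions alike, whereas the Sobolev exponent 2m/(m-2) degenerates at m = 2. The weak equation
  admits only smooth test functions, so the truncation is smoothed and applied to the test functions
  approximating v; closing the smooth functions under sums, products and powers serves this
  composition. The factor \<open>lambda1\<close> does not depend on p, but its sign decides whether
  monotonicity survives multiplication by it. Monotonicity is essential at the end: pointwise
  left-continuity alone bounds the lower limit of the suprema, and the upper bound comes from
  comparing each exponent q < p with p.\<close>

lemma smooth_funD:
  assumes "smooth_fun f"
  shows "f differentiable_on UNIV" "continuous_on UNIV f"
    "b \<in> Basis \<Longrightarrow> smooth_fun (\<lambda>x. frechet_derivative f (at x) b)"
  using assms by (auto elim: smooth_fun.cases)

text \<open>The coinduction runs over all constants at once, since the derivative of the constant c
  is the constant 0.\<close>

lemma smooth_fun_const: "smooth_fun (\<lambda>x::'a::euclidean_space. c)"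
proof -
  have "\<exists>c. f = (\<lambda>x::'a. c) \<Longrightarrow> smooth_fun f" for f
  proof (coinduction arbitrary: f rule: smooth_fun.coinduct)
    case smooth_fun
    then obtain c where f: "f = (\<lambda>x. c)" by blast
    have "frechet_derivative f (at x) b = 0" for x b
      using frechet_derivative_at[of f "\<lambda>_. 0" x] by (simp add: f)
    then show ?case using f by (auto simp: differentiable_on_def)
  qed
  then show ?thesis by blast
qed

text \<open>Coinduction up to algebraic operations: the closure is stable under partial derivatives.\<close>
inductive smooth_closure :: "('a::euclidean_space \<Rightarrow> real) \<Rightarrow> bool" where
  base: "smooth_fun f \<Longrightarrow> smooth_closure f"
| add: "smooth_closure f \<Longrightarrow> smooth_closure g \<Longrightarrow> smooth_closure (\<lambda>x. f x + g x)"
| mult: "smooth_closure f \<Longrightarrow> smooth_closure g \<Longrightarrow> smooth_closure (\<lambda>x. f x * g x)"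
| powr: "smooth_closure f \<Longrightarrow> (\<And>x. f x > 0) \<Longrightarrow> smooth_closure (\<lambda>x. f x powr a)"

text \<open>Differentiating a power lowers its exponent from a to a - 1, so the \<open>powr\<close>
  rule has to admit every real exponent; positivity of the base makes the chain rule applicable at
  every point.\<close>

lemma smooth_closure_derivative:
  fixes f :: "'a::euclidean_space \<Rightarrow> real"
  assumes "smooth_closure f"
  shows "(\<forall>x. f differentiable (at x)) \<and>
    (\<forall>b\<in>Basis. smooth_closure (\<lambda>x. frechet_derivative f (at x) b))"
  using assms
proof induction
  case (base f)
  then show ?case
    using smooth_funD[OF base] by (auto simp: differentiable_on_def intro: smooth_closure.base)
next
  case (add f g)
  have d: "((\<lambda>x. f x + g x) has_derivative
      (\<lambda>h. frechet_derivative f (at x) h + frechet_derivative g (at x) h)) (at x)" for x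
    using add.IH by (intro derivative_intros) (auto simp: frechet_derivative_works)
  show ?case
    using add.IH d
    by (auto simp: frechet_derivative_at[OF d, symmetric] differentiable_def intro!: smooth_closure.add)
next
  case (mult f g)
  have d: "((\<lambda>x. f x * g x) has_derivative
      (\<lambda>h. f x * frechet_derivative g (at x) h + frechet_derivative f (at x) h * g x)) (at x)" for x
    using mult.IH by (intro derivative_intros) (auto simp: frechet_derivative_works)
  show ?case
    using mult d
    by (auto simp: frechet_derivative_at[OF d, symmetric] differentiable_def
        intro!: smooth_closure.add smooth_closure.mult)
next
  case (powr f a)
  have d: "((\<lambda>x. f x powr a) has_derivative
      (\<lambda>h. (a * f x powr (a - 1)) * frechet_derivative f (at x) h)) (at x)" for x
  proof -
    have "(f has_derivative frechet_derivative f (at x)) (at x)"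
      using powr.IH by (auto simp: frechet_derivative_works)
    moreover have "((\<lambda>t. t powr a) has_real_derivative (a * f x powr (a - 1))) (at (f x))"
      using powr.hyps(2)[of x] by (intro has_real_derivative_powr) auto
    ultimately show ?thesis
      using DERIV_compose_FDERIV[of "\<lambda>t. t powr a" "a * f x powr (a - 1)" f x
          "frechet_derivative f (at x)" UNIV] by (simp add: mult.commute)
  qed
  have "smooth_closure (\<lambda>x. (a * f x powr (a - 1)) * frechet_derivative f (at x) b)"
    if "b \<in> Basis" for b
    using powr that
    by (intro smooth_closure.mult smooth_closure.powr smooth_closure.base[OF smooth_fun_const]) auto
  then show ?case
    using d by (auto simp: frechet_derivative_at[OF d, symmetric] differentiable_def)
qed

text \<open>A class of differentiable functions stable under partial derivatives lies inside the
  greatest such class, which is \<open>smooth_fun\<close>.\<close>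

lemma smooth_fun_eq_closure: "smooth_fun f \<longleftrightarrow> smooth_closure f"
proof
  show "smooth_closure f \<Longrightarrow> smooth_fun f"
  proof (coinduction arbitrary: f rule: smooth_fun.coinduct)
    case smooth_fun
    then have "\<forall>x. f differentiable (at x)"
      "\<forall>b\<in>Basis. smooth_closure (\<lambda>x. frechet_derivative f (at x) b)"
      using smooth_closure_derivative by blast+
    then show ?case
      by (auto simp: differentiable_on_def continuous_on_eq_continuous_at
          intro: differentiable_imp_continuous_within)
  qed
qed (rule smooth_closure.base)

lemma smooth_fun_add: "smooth_fun f \<Longrightarrow> smooth_fun g \<Longrightarrow> smooth_fun (\<lambda>x. f x + g x)"
  and smooth_fun_mult: "smooth_fun f \<Longrightarrow> smooth_fun g \<Longrightarrow> smooth_fun (\<lambda>x. f x * g x)"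
  and smooth_fun_powr: "smooth_fun f \<Longrightarrow> (\<And>x. f x > 0) \<Longrightarrow> smooth_fun (\<lambda>x. f x powr a)"
  by (simp_all add: smooth_fun_eq_closure smooth_closure.intros)

lemma smooth_fun_has_derivative_grad:
  fixes f :: "'a::euclidean_space \<Rightarrow> real"
  assumes "smooth_fun f"
  shows "(f has_derivative (\<lambda>h. grad f x \<bullet> h)) (at x)"
proof -
  have d: "(f has_derivative frechet_derivative f (at x)) (at x)"
    using smooth_funD(1)[OF assms] by (auto simp: frechet_derivative_works differentiable_on_def)
  then have lin: "linear (frechet_derivative f (at x))"
    using has_derivative_linear by blast
  have "frechet_derivative f (at x) h = grad f x \<bullet> h" for h
  proof -
    have "frechet_derivative f (at x) h = frechet_derivative f (at x) (\<Sum>b\<in>Basis. (h \<bullet> b) *\<^sub>R b)"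
      by (simp add: euclidean_representation)
    also have "\<dots> = (\<Sum>b\<in>Basis. (h \<bullet> b) * frechet_derivative f (at x) b)"
      by (simp add: linear_sum[OF lin] linear_scale[OF lin])
    also have "\<dots> = grad f x \<bullet> h"
      by (simp add: grad_def inner_sum_left inner_commute[of h] mult.commute)
    finally show ?thesis .
  qed
  then show ?thesis using d by (metis (no_types, lifting) ext)
qed

lemma grad_eqI:
  fixes f :: "'a::euclidean_space \<Rightarrow> real"
  assumes "(f has_derivative (\<lambda>h. v \<bullet> h)) (at x)"
  shows "grad f x = v"
  by (simp add: grad_def frechet_derivative_at[OF assms, symmetric] euclidean_representation)

lemma smooth_fun_continuous_grad:
  assumes "smooth_fun f"
  shows "continuous_on UNIV (grad f)"
  unfolding grad_def using smooth_funD(2)[OF smooth_funD(3)[OF assms]]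
  by (intro continuous_intros) auto

lemma test_funD:
  assumes "test_fun \<Omega> f"
  shows "smooth_fun f" "continuous_on UNIV f" "continuous_on UNIV (grad f)"
    "x \<notin> \<Omega> \<Longrightarrow> f x = 0" "x \<notin> \<Omega> \<Longrightarrow> grad f x = 0"
proof -
  show s: "smooth_fun f" and "continuous_on UNIV f" "continuous_on UNIV (grad f)"
    using assms smooth_funD(2) smooth_fun_continuous_grad by (auto simp: test_fun_def)
  have sub: "closure {x. f x \<noteq> 0} \<subseteq> \<Omega>"
    using assms by (auto simp: test_fun_def)
  show "f x = 0" if "x \<notin> \<Omega>"
    using that sub closure_subset[of "{x. f x \<noteq> 0}"] by auto
  show "grad f x = 0" if "x \<notin> \<Omega>"
  proof (rule grad_eqI)
    have x: "x \<in> - closure {x. f x \<noteq> 0}" using that sub by auto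
    have "((\<lambda>x. 0) has_derivative (\<lambda>h. 0)) (at x)" by simp
    then have "(f has_derivative (\<lambda>h. 0)) (at x)"
    proof (rule has_derivative_transform_within_open[OF _ _ x])
      show "0 = f y" if "y \<in> - closure {x. f x \<noteq> 0}" for y
        using that closure_subset[of "{x. f x \<noteq> 0}"] by auto
    qed auto
    then show "(f has_derivative (\<lambda>h. 0 \<bullet> h)) (at x)" by simp
  qed
qed

lemma test_fun_bounded:
  fixes f :: "'a::euclidean_space \<Rightarrow> real"
  assumes "test_fun \<Omega> f"
  obtains B where "\<And>x. norm (f x) \<le> B" "\<And>x. norm (grad f x) \<le> B"
proof -
  let ?K = "closure {x. f x \<noteq> 0}"
  \<comment> \<open>A test function is also one for its own support, so both f and its gradient
    vanish off \<open>?K\<close> and bounds on this compact set suffice.\<close>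
  have K: "compact ?K" and t: "test_fun ?K f" using assms by (auto simp: test_fun_def)
  have "bounded (f ` ?K)" "bounded (grad f ` ?K)"
    using test_funD(2,3)[OF assms] K
    by (meson compact_continuous_image compact_imp_bounded continuous_on_subset subset_UNIV)+
  then obtain B1 B2 where "\<forall>x\<in>?K. norm (f x) \<le> B1" "\<forall>x\<in>?K. norm (grad f x) \<le> B2"
    by (auto simp: bounded_iff)
  then have "norm (f x) \<le> max 0 (max B1 B2)" "norm (grad f x) \<le> max 0 (max B1 B2)" for x
    using test_funD(4,5)[OF t, of x] by (cases "x \<in> ?K"; force simp: max_def)+
  then show ?thesis using that by blast
qed

lemma test_fun_compose:
  fixes f :: "'a::euclidean_space \<Rightarrow> real"
  assumes "test_fun \<Omega> f" "smooth_fun g" "\<And>x. f x = 0 \<Longrightarrow> g x = 0"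
  shows "test_fun \<Omega> g"
proof -
  have "closure {x. g x \<noteq> 0} \<subseteq> closure {x. f x \<noteq> 0}"
    using assms(3) by (intro closure_mono) auto
  then show ?thesis
    using assms(1,2) unfolding test_fun_def compact_eq_bounded_closed
    by (auto intro: bounded_subset)
qed

lemma test_fun_zero: "test_fun \<Omega> (\<lambda>x. 0)"
  by (simp add: test_fun_def smooth_fun_const)

lemma test_fun_add_scale:
  assumes f: "test_fun \<Omega> f" and g: "test_fun \<Omega> g"
  shows "test_fun \<Omega> (\<lambda>x. f x + c * g x)"
    and "grad (\<lambda>x. f x + c * g x) = (\<lambda>x. grad f x + c *\<^sub>R grad g x)"
proof -
  have s: "smooth_fun (\<lambda>x. f x + c * g x)"
    using f g by (intro smooth_fun_add smooth_fun_mult smooth_fun_const) (auto simp: test_fun_def)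
  have sub: "closure {x. f x + c * g x \<noteq> 0} \<subseteq> closure {x. f x \<noteq> 0} \<union> closure {x. g x \<noteq> 0}"
    unfolding closure_Un[symmetric] by (intro closure_mono) auto
  have "compact (closure {x. f x \<noteq> 0} \<union> closure {x. g x \<noteq> 0})"
    using f g by (auto simp: test_fun_def)
  then have "compact (closure {x. f x + c * g x \<noteq> 0})"
    using sub unfolding compact_eq_bounded_closed by (meson bounded_subset closed_closure)
  then show "test_fun \<Omega> (\<lambda>x. f x + c * g x)"
    using s sub f g by (auto simp: test_fun_def)
  show "grad (\<lambda>x. f x + c * g x) = (\<lambda>x. grad f x + c *\<^sub>R grad g x)"
  proof
    fix x
    show "grad (\<lambda>x. f x + c * g x) x = grad f x + c *\<^sub>R grad g x"
      by (rule grad_eqI)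
        (auto simp: inner_add_left intro!: derivative_eq_intros
          smooth_fun_has_derivative_grad test_funD(1)[OF f] test_funD(1)[OF g])
  qed
qed

text \<open>A smooth increasing approximation of \<open>t \<mapsto> max 0 (t - k)\<close>, normalised to vanish at 0.\<close>
definition soft_plus :: "real \<Rightarrow> real \<Rightarrow> real \<Rightarrow> real" where
  "soft_plus k e t = (sqrt ((t - k)\<^sup>2 + e\<^sup>2) + (t - k)) / 2 - (sqrt (k\<^sup>2 + e\<^sup>2) - k) / 2"

text \<open>Since sqrt(s^2 + e^2) lies between \<bar>s\<bar> and \<bar>s\<bar> + e, the smoothed
  positive part and the normalising constant each err upwards by at most e/2.\<close>

lemma soft_plus_approx:
  assumes "k \<ge> 0" "e > 0"
  shows "\<bar>soft_plus k e t - max 0 (t - k)\<bar> \<le> e"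
proof -
  have s: "\<bar>s\<bar> \<le> sqrt (s\<^sup>2 + e\<^sup>2)" "sqrt (s\<^sup>2 + e\<^sup>2) \<le> \<bar>s\<bar> + e" for s
    using sqrt_sum_squares_le_sum_abs[of s e] assms real_sqrt_le_mono[of "s\<^sup>2" "s\<^sup>2 + e\<^sup>2"] by auto
  define p where "p = sqrt ((t - k)\<^sup>2 + e\<^sup>2)"
  define q where "q = sqrt (k\<^sup>2 + e\<^sup>2)"
  have "\<bar>t - k\<bar> \<le> p" "p \<le> \<bar>t - k\<bar> + e" "k \<le> q" "q \<le> k + e"
    using s[of "t - k"] s[of k] assms by (auto simp: p_def q_def)
  then have "\<bar>(p + (t - k)) / 2 - (q - k) / 2 - max 0 (t - k)\<bar> \<le> e"
    by (cases "t \<ge> k") (auto simp: max_def abs_le_iff field_simps)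
  then show ?thesis by (simp add: soft_plus_def p_def q_def)
qed

text \<open>The normalisation at 0 keeps the support inside that of f. The factor s is the
  derivative (1 + (t - k) / sqrt((t - k)^2 + e^2)) / 2 at t = f x; only its range matters
  afterwards.\<close>

lemma test_fun_soft_plus:
  fixes f :: "'a::euclidean_space \<Rightarrow> real"
  assumes f: "test_fun \<Omega> f" and e: "e > 0"
  shows "test_fun \<Omega> (\<lambda>x. soft_plus k e (f x))"
    and "\<exists>s. 0 \<le> s \<and> s \<le> 1 \<and> grad (\<lambda>x. soft_plus k e (f x)) x = s *\<^sub>R grad f x"
proof -
  have pos: "(t - k)\<^sup>2 + e\<^sup>2 > 0" for t
    using e by (simp add: add_nonneg_pos)
  \<comment> \<open>The square root is written as the power 1/2 of a strictly positive polynomial in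
    f, a form covered by the closure rules.\<close>
  have "smooth_fun (\<lambda>x. ((f x + - k) * (f x + - k) + e\<^sup>2) powr (1 / 2))"
    using pos test_funD(1)[OF f]
    by (intro smooth_fun_powr smooth_fun_add smooth_fun_mult smooth_fun_const)
      (auto simp: power2_eq_square)
  then have "smooth_fun (\<lambda>x. (1 / 2) * (((f x + - k) * (f x + - k) + e\<^sup>2) powr (1 / 2) + (f x + - k))
      + - ((sqrt (k\<^sup>2 + e\<^sup>2) - k) / 2))"
    using test_funD(1)[OF f] by (intro smooth_fun_add smooth_fun_mult smooth_fun_const)
  also have "(\<lambda>x. (1 / 2) * (((f x + - k) * (f x + - k) + e\<^sup>2) powr (1 / 2) + (f x + - k))
      + - ((sqrt (k\<^sup>2 + e\<^sup>2) - k) / 2)) = (\<lambda>x. soft_plus k e (f x))"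
  proof
    fix x
    show "(1 / 2) * (((f x + - k) * (f x + - k) + e\<^sup>2) powr (1 / 2) + (f x + - k))
      + - ((sqrt (k\<^sup>2 + e\<^sup>2) - k) / 2) = soft_plus k e (f x)"
      using pos[of "f x"] by (simp add: soft_plus_def powr_half_sqrt power2_eq_square)
  qed
  finally have sm: "smooth_fun (\<lambda>x. soft_plus k e (f x))" .
  show "test_fun \<Omega> (\<lambda>x. soft_plus k e (f x))"
    by (rule test_fun_compose[OF f sm]) (simp add: soft_plus_def)
  define r where "r = sqrt ((f x - k)\<^sup>2 + e\<^sup>2)"
  define s where "s = ((f x - k) / r + 1) / 2"
  have r: "r > 0" "\<bar>f x - k\<bar> \<le> r"
    using pos[of "f x"] real_sqrt_le_mono[of "(f x - k)\<^sup>2" "(f x - k)\<^sup>2 + e\<^sup>2"] by (auto simp: r_def)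
  have s_eq: "((2 * (f x - k)) * (inverse r / 2) + 1) / 2 = s"
    using r by (simp add: s_def divide_simps)
  have "(soft_plus k e has_real_derivative
      ((2 * (f x - k)) * (inverse (sqrt ((f x - k)\<^sup>2 + e\<^sup>2)) / 2) + 1) / 2) (at (f x))"
    unfolding soft_plus_def[abs_def] using pos[of "f x"]
    by (auto intro!: derivative_eq_intros)
  then have "(soft_plus k e has_real_derivative s) (at (f x))"
    unfolding r_def[symmetric] s_eq .
  then have "((\<lambda>x. soft_plus k e (f x)) has_derivative (\<lambda>h. (grad f x \<bullet> h) * s)) (at x)"
    by (rule DERIV_compose_FDERIV) (rule smooth_fun_has_derivative_grad[OF test_funD(1)[OF f]])
  then have "grad (\<lambda>x. soft_plus k e (f x)) x = s *\<^sub>R grad f x"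
    by (intro grad_eqI) (simp add: mult.commute)
  moreover have "0 \<le> s" "s \<le> 1"
    using r by (auto simp: s_def field_simps abs_le_iff)
  ultimately show "\<exists>s. 0 \<le> s \<and> s \<le> 1 \<and> grad (\<lambda>x. soft_plus k e (f x)) x = s *\<^sub>R grad f x"
    by blast
qed

section \<open>A Nash type inequality\<close>

lemma nn_integral_lborel_translate:
  fixes g :: "'a::euclidean_space \<Rightarrow> ennreal"
  assumes [measurable]: "g \<in> borel_measurable borel"
  shows "(\<integral>\<^sup>+x. g (x + h) \<partial>lborel) = (\<integral>\<^sup>+x. g x \<partial>lborel)"
proof -
  have "(\<integral>\<^sup>+x. g x \<partial>lborel) = (\<integral>\<^sup>+x. g x \<partial>distr lborel borel ((+) h))"
    by (simp add: lborel_distr_plus)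
  also have "\<dots> = (\<integral>\<^sup>+x. g (x + h) \<partial>lborel)"
    by (subst nn_integral_distr) (auto simp: add.commute)
  finally show ?thesis by simp
qed

text \<open>Integrate \<open>2 c g - c\<^sup>2 \<le> g\<^sup>2\<close> with \<open>c = F 1 - F 0\<close>.\<close>
lemma increment_square_le:
  fixes F g :: "real \<Rightarrow> real"
  assumes F: "\<And>t. (F has_real_derivative g t) (at t)" and g: "continuous_on UNIV g"
  shows "ennreal ((F 1 - F 0)\<^sup>2) \<le> (\<integral>\<^sup>+t. ennreal ((g t)\<^sup>2) * indicator {0..1} t \<partial>lborel)"
proof -
  have gc: "isCont g t" for t using g by (simp add: continuous_on_eq_continuous_at)
  define c where "c = F 1 - F 0"
  have 1: "has_bochner_integral lborel (\<lambda>t. (2 * c * g t - c\<^sup>2) * indicator {0..1} t)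
      ((2 * c * F 1 - c\<^sup>2 * 1) - (2 * c * F 0 - c\<^sup>2 * 0))"
    using F gc by (intro has_bochner_integral_FTC_Icc_real continuous_intros)
      (auto intro!: derivative_eq_intros)
  have 2: "integrable lborel (\<lambda>t. (g t)\<^sup>2 * indicator {0..1} t)"
    using gc by (intro borel_integrable_atLeastAtMost) (auto intro!: continuous_intros)
  have "c\<^sup>2 = (\<integral>t. (2 * c * g t - c\<^sup>2) * indicator {0..1} t \<partial>lborel)"
    using has_bochner_integral_integral_eq[OF 1] by (simp add: c_def power2_eq_square algebra_simps)
  also have "\<dots> \<le> (\<integral>t. (g t)\<^sup>2 * indicator {0..1} t \<partial>lborel)"
  proof (rule integral_mono)
    show "(2 * c * g t - c\<^sup>2) * indicator {0..1} t \<le> (g t)\<^sup>2 * indicator {0..1} t" for t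
      using zero_le_power2[of "g t - c"]
      by (intro mult_right_mono) (auto simp: power2_diff algebra_simps)
  qed (use 1 2 in \<open>auto simp: has_bochner_integral_iff\<close>)
  finally have "ennreal (c\<^sup>2) \<le> ennreal (\<integral>t. (g t)\<^sup>2 * indicator {0..1} t \<partial>lborel)"
    by (rule ennreal_leI)
  also have "\<dots> = (\<integral>\<^sup>+t. ennreal ((g t)\<^sup>2 * indicator {0..1} t) \<partial>lborel)"
    using 2 by (subst nn_integral_eq_integral) auto
  also have "\<dots> = (\<integral>\<^sup>+t. ennreal ((g t)\<^sup>2) * indicator {0..1} t \<partial>lborel)"
    by (intro nn_integral_cong) (auto split: split_indicator)
  finally show ?thesis by (simp add: c_def)
qed

text \<open>The increment is the integral of the directional derivative along the segment from x to
  x + h. After Cauchy-Schwarz and Fubini, translation invariance in x removes the dependence on the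
  position t on the segment.\<close>

lemma translation_L2_le:
  fixes f :: "'a::euclidean_space \<Rightarrow> real"
  assumes f: "smooth_fun f"
  shows "(\<integral>\<^sup>+x. ennreal ((f (x + h) - f x)\<^sup>2) \<partial>lborel)
    \<le> ennreal ((norm h)\<^sup>2) * (\<integral>\<^sup>+x. ennreal ((norm (grad f x))\<^sup>2) \<partial>lborel)"
proof -
  have [measurable]: "f \<in> borel_measurable borel" "grad f \<in> borel_measurable borel"
    using smooth_funD(2)[OF f] smooth_fun_continuous_grad[OF f]
    by (auto intro: borel_measurable_continuous_onI)
  have "ennreal ((f (x + h) - f x)\<^sup>2)
    \<le> (\<integral>\<^sup>+t. ennreal ((grad f (x + t *\<^sub>R h) \<bullet> h)\<^sup>2) * indicator {0..1} t \<partial>lborel)" for x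
  proof -
    have "((\<lambda>t. f (x + t *\<^sub>R h)) has_derivative (\<lambda>s. grad f (x + t *\<^sub>R h) \<bullet> (s *\<^sub>R h))) (at t)" for t
      by (rule has_derivative_compose[OF _ smooth_fun_has_derivative_grad[OF f]])
        (auto intro!: derivative_eq_intros)
    then have "((\<lambda>t. f (x + t *\<^sub>R h)) has_real_derivative grad f (x + t *\<^sub>R h) \<bullet> h) (at t)" for t
      by (simp add: has_field_derivative_def mult_commute_abs)
    moreover have "continuous_on UNIV (\<lambda>t. grad f (x + t *\<^sub>R h) \<bullet> h)"
      by (intro continuous_intros continuous_on_compose2[OF smooth_fun_continuous_grad[OF f]]) auto
    ultimately show ?thesis
      using increment_square_le[of "\<lambda>t. f (x + t *\<^sub>R h)" "\<lambda>t. grad f (x + t *\<^sub>R h) \<bullet> h"] by simp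
  qed
  then have "(\<integral>\<^sup>+x. ennreal ((f (x + h) - f x)\<^sup>2) \<partial>lborel)
    \<le> (\<integral>\<^sup>+x. \<integral>\<^sup>+t. ennreal ((grad f (x + t *\<^sub>R h) \<bullet> h)\<^sup>2) * indicator {0..1} t \<partial>lborel \<partial>lborel)"
    by (rule nn_integral_mono)
  also have "\<dots> = (\<integral>\<^sup>+t. \<integral>\<^sup>+x. ennreal ((grad f (x + t *\<^sub>R h) \<bullet> h)\<^sup>2) * indicator {0..1} t \<partial>lborel \<partial>lborel)"
    by (rule lborel_pair.Fubini') measurable
  also have "\<dots> \<le> (\<integral>\<^sup>+t. (\<integral>\<^sup>+x. ennreal ((norm h)\<^sup>2) * ennreal ((norm (grad f (x + t *\<^sub>R h)))\<^sup>2) \<partial>lborel)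
      * indicator {0..1} (t::real) \<partial>lborel)"
  proof (rule nn_integral_mono)
    fix t :: real
    have "(grad f y \<bullet> h)\<^sup>2 \<le> (norm h)\<^sup>2 * (norm (grad f y))\<^sup>2" for y
      using Cauchy_Schwarz_ineq[of "grad f y" h] by (simp add: power2_norm_eq_inner mult.commute)
    then have "(\<integral>\<^sup>+x. ennreal ((grad f (x + t *\<^sub>R h) \<bullet> h)\<^sup>2) \<partial>lborel)
       \<le> (\<integral>\<^sup>+x. ennreal ((norm h)\<^sup>2) * ennreal ((norm (grad f (x + t *\<^sub>R h)))\<^sup>2) \<partial>lborel)"
      by (intro nn_integral_mono) (simp add: ennreal_mult[symmetric] ennreal_leI)
    then show "(\<integral>\<^sup>+x. ennreal ((grad f (x + t *\<^sub>R h) \<bullet> h)\<^sup>2) * indicator {0..1} t \<partial>lborel)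
      \<le> (\<integral>\<^sup>+x. ennreal ((norm h)\<^sup>2) * ennreal ((norm (grad f (x + t *\<^sub>R h)))\<^sup>2) \<partial>lborel) * indicator {0..1} t"
      by (auto split: split_indicator)
  qed
  also have "\<dots> = (\<integral>\<^sup>+t. (ennreal ((norm h)\<^sup>2) * (\<integral>\<^sup>+x. ennreal ((norm (grad f x))\<^sup>2) \<partial>lborel))
      * indicator {0..1} (t::real) \<partial>lborel)"
    by (subst nn_integral_lborel_translate[where g = "\<lambda>x. ennreal ((norm h)\<^sup>2) * ennreal ((norm (grad f x))\<^sup>2)"])
      (auto simp: nn_integral_cmult)
  also have "\<dots> = ennreal ((norm h)\<^sup>2) * (\<integral>\<^sup>+x. ennreal ((norm (grad f x))\<^sup>2) \<partial>lborel)"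
    by (subst nn_integral_cmult_indicator) auto
  finally show ?thesis .
qed

text \<open>Integrate \<open>f(x+h)\<^sup>2 + f(x)\<^sup>2 \<le> (f(x+h) - f(x))\<^sup>2 + 2 \<bar>f(x) f(x+h)\<bar>\<close> over all \<open>x\<close> and all \<open>h\<close> in a ball.\<close>
lemma Nash_inequality_nn:
  fixes f :: "'a::euclidean_space \<Rightarrow> real"
  assumes f: "smooth_fun f" and R: "R \<ge> 0"
  defines "V \<equiv> emeasure lborel (ball (0::'a) R)"
  shows "2 * (V * (\<integral>\<^sup>+x. ennreal ((f x)\<^sup>2) \<partial>lborel))
    \<le> V * (ennreal (R\<^sup>2) * (\<integral>\<^sup>+x. ennreal ((norm (grad f x))\<^sup>2) \<partial>lborel))
       + 2 * (\<integral>\<^sup>+x. ennreal \<bar>f x\<bar> \<partial>lborel)\<^sup>2"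
proof -
  let ?I = "indicator (ball (0::'a) R) :: 'a \<Rightarrow> ennreal"
  let ?S = "\<integral>\<^sup>+x. ennreal ((f x)\<^sup>2) \<partial>lborel" and ?L = "\<integral>\<^sup>+x. ennreal \<bar>f x\<bar> \<partial>lborel"
    and ?D = "\<integral>\<^sup>+x. ennreal ((norm (grad f x))\<^sup>2) \<partial>lborel"
  have [measurable]: "f \<in> borel_measurable borel" "grad f \<in> borel_measurable borel"
    using smooth_funD(2)[OF f] smooth_fun_continuous_grad[OF f]
    by (auto intro: borel_measurable_continuous_onI)
  have pt: "ennreal ((f (x + h))\<^sup>2) + ennreal ((f x)\<^sup>2)
      \<le> ennreal ((f (x + h) - f x)\<^sup>2) + 2 * (ennreal \<bar>f x\<bar> * ennreal \<bar>f (x + h)\<bar>)" for x h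
  proof -
    have "(f (x + h))\<^sup>2 + (f x)\<^sup>2 \<le> (f (x + h) - f x)\<^sup>2 + 2 * (\<bar>f x\<bar> * \<bar>f (x + h)\<bar>)"
      using abs_ge_self[of "f x * f (x + h)"] by (simp add: power2_diff abs_mult mult.commute)
    then have "ennreal ((f (x + h))\<^sup>2 + (f x)\<^sup>2) \<le> ennreal ((f (x + h) - f x)\<^sup>2 + 2 * (\<bar>f x\<bar> * \<bar>f (x + h)\<bar>))"
      by (rule ennreal_leI)
    then show ?thesis by (simp add: ennreal_mult)
  qed
  have "2 * ?S \<le> ennreal (R\<^sup>2) * ?D + 2 * (\<integral>\<^sup>+x. ennreal \<bar>f x\<bar> * ennreal \<bar>f (x + h)\<bar> \<partial>lborel)"
    if "h \<in> ball 0 R" for h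
  proof -
    have "2 * ?S = (\<integral>\<^sup>+x. ennreal ((f (x + h))\<^sup>2) + ennreal ((f x)\<^sup>2) \<partial>lborel)"
      by (simp add: nn_integral_add nn_integral_lborel_translate[where g = "\<lambda>x. ennreal ((f x)\<^sup>2)"] mult_2)
    also have "\<dots> \<le> (\<integral>\<^sup>+x. ennreal ((f (x + h) - f x)\<^sup>2) + 2 * (ennreal \<bar>f x\<bar> * ennreal \<bar>f (x + h)\<bar>) \<partial>lborel)"
      by (intro nn_integral_mono pt)
    also have "\<dots> = (\<integral>\<^sup>+x. ennreal ((f (x + h) - f x)\<^sup>2) \<partial>lborel)
        + 2 * (\<integral>\<^sup>+x. ennreal \<bar>f x\<bar> * ennreal \<bar>f (x + h)\<bar> \<partial>lborel)"
      by (simp add: nn_integral_add nn_integral_cmult)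
    also have "\<dots> \<le> ennreal (R\<^sup>2) * ?D + 2 * (\<integral>\<^sup>+x. ennreal \<bar>f x\<bar> * ennreal \<bar>f (x + h)\<bar> \<partial>lborel)"
    proof (intro add_right_mono order_trans[OF translation_L2_le[OF f]] mult_right_mono ennreal_leI)
      show "(norm h)\<^sup>2 \<le> R\<^sup>2" using that by (intro power_mono) auto
    qed auto
    finally show ?thesis .
  qed
  \<comment> \<open>The indicator of the ball stays on the first two terms but is dropped from the
    cross term. Over all h that term factorises into the square of the integral of
    \<bar>f\<bar>.\<close>
  then have "(\<integral>\<^sup>+h. (2 * ?S) * ?I h \<partial>lborel)
    \<le> (\<integral>\<^sup>+h. (ennreal (R\<^sup>2) * ?D) * ?I h + 2 * (\<integral>\<^sup>+x. ennreal \<bar>f x\<bar> * ennreal \<bar>f (x + h)\<bar> \<partial>lborel) \<partial>lborel)"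
    by (intro nn_integral_mono) (auto split: split_indicator)
  also have "\<dots> = (ennreal (R\<^sup>2) * ?D) * V
      + 2 * (\<integral>\<^sup>+h. \<integral>\<^sup>+x. ennreal \<bar>f x\<bar> * ennreal \<bar>f (x + h)\<bar> \<partial>lborel \<partial>lborel)"
  proof -
    have [measurable]: "?I \<in> borel_measurable borel"
      by (intro borel_measurable_indicator borel_open open_ball)
    show ?thesis
      by (subst nn_integral_add; (measurable)?) (simp add: nn_integral_cmult nn_integral_cmult_indicator V_def)
  qed
  also have "(\<integral>\<^sup>+h. \<integral>\<^sup>+x. ennreal \<bar>f x\<bar> * ennreal \<bar>f (x + h)\<bar> \<partial>lborel \<partial>lborel)
     = (\<integral>\<^sup>+x. \<integral>\<^sup>+h. ennreal \<bar>f x\<bar> * ennreal \<bar>f (h + x)\<bar> \<partial>lborel \<partial>lborel)"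
    by (subst lborel_pair.Fubini') (auto simp: add.commute)
  also have "\<dots> = (\<integral>\<^sup>+x. ennreal \<bar>f x\<bar> * ?L \<partial>lborel)"
    by (simp add: nn_integral_cmult nn_integral_lborel_translate[where g = "\<lambda>x. ennreal \<bar>f x\<bar>"])
  also have "\<dots> = ?L\<^sup>2"
    by (simp add: nn_integral_multc power2_eq_square)
  also have "(\<integral>\<^sup>+h. (2 * ?S) * ?I h \<partial>lborel) = (2 * ?S) * V"
    unfolding V_def by (rule nn_integral_cmult_indicator) simp
  finally show ?thesis by (simp add: mult_ac)
qed

section \<open>Square integrable functions\<close>

lemma integrable_mult_L2:
  fixes f g :: "'a \<Rightarrow> real"
  assumes [measurable]: "f \<in> borel_measurable M" "g \<in> borel_measurable M"
    and f: "integrable M (\<lambda>x. (f x)\<^sup>2)" and g: "integrable M (\<lambda>x. (g x)\<^sup>2)"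
  shows "integrable M (\<lambda>x. f x * g x)"
proof (rule Bochner_Integration.integrable_bound[OF Bochner_Integration.integrable_add[OF f g]])
  show "AE x in M. norm (f x * g x) \<le> norm ((f x)\<^sup>2 + (g x)\<^sup>2)"
  proof (rule AE_I2)
    fix x
    have "2 * (\<bar>f x\<bar> * \<bar>g x\<bar>) \<le> \<bar>f x\<bar>\<^sup>2 + \<bar>g x\<bar>\<^sup>2"
      using sum_squares_bound[of "\<bar>f x\<bar>" "\<bar>g x\<bar>"] by simp
    moreover have "0 \<le> \<bar>f x\<bar> * \<bar>g x\<bar>" by simp
    ultimately show "norm (f x * g x) \<le> norm ((f x)\<^sup>2 + (g x)\<^sup>2)"
      unfolding real_norm_def abs_mult power2_abs by linarith
  qed
qed simp

lemma Cauchy_Schwarz_integral: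
  fixes f g :: "'a \<Rightarrow> real"
  assumes [measurable]: "f \<in> borel_measurable M" "g \<in> borel_measurable M"
    and f: "integrable M (\<lambda>x. (f x)\<^sup>2)" and g: "integrable M (\<lambda>x. (g x)\<^sup>2)"
  shows "(\<integral>x. \<bar>f x * g x\<bar> \<partial>M)\<^sup>2 \<le> (\<integral>x. (f x)\<^sup>2 \<partial>M) * (\<integral>x. (g x)\<^sup>2 \<partial>M)"
proof -
  have fg: "integrable M (\<lambda>x. f x * g x)" by (rule integrable_mult_L2) (use assms in auto)
  have "(\<integral>\<^sup>+x. ennreal \<bar>f x\<bar> * ennreal \<bar>g x\<bar> \<partial>M)\<^sup>2
      \<le> (\<integral>\<^sup>+x. (ennreal \<bar>f x\<bar>)\<^sup>2 \<partial>M) * (\<integral>\<^sup>+x. (ennreal \<bar>g x\<bar>)\<^sup>2 \<partial>M)"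
    by (rule Cauchy_Schwarz_nn_integral) auto
  also have "(\<integral>\<^sup>+x. ennreal \<bar>f x\<bar> * ennreal \<bar>g x\<bar> \<partial>M) = ennreal (\<integral>x. \<bar>f x * g x\<bar> \<partial>M)"
    using integrable_abs[OF fg]
    by (subst nn_integral_eq_integral[symmetric]) (auto simp: ennreal_mult[symmetric] abs_mult)
  also have "(\<integral>\<^sup>+x. (ennreal \<bar>f x\<bar>)\<^sup>2 \<partial>M) = ennreal (\<integral>x. (f x)\<^sup>2 \<partial>M)"
    using f by (subst nn_integral_eq_integral[symmetric]) (auto simp: ennreal_power)
  also have "(\<integral>\<^sup>+x. (ennreal \<bar>g x\<bar>)\<^sup>2 \<partial>M) = ennreal (\<integral>x. (g x)\<^sup>2 \<partial>M)"
    using g by (subst nn_integral_eq_integral[symmetric]) (auto simp: ennreal_power)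
  finally show ?thesis
    by (simp add: ennreal_power ennreal_mult[symmetric] ennreal_le_iff)
qed

text \<open>Cauchy-Schwarz: pairing a null sequence of L2 with a fixed square integrable function
  gives a null sequence of L1. It removes the error terms in all later limits.\<close>

lemma L2_null_mult:
  fixes a :: "nat \<Rightarrow> 'a \<Rightarrow> real"
  assumes "\<And>j. a j \<in> borel_measurable M" "b \<in> borel_measurable M"
    and "\<And>j. integrable M (\<lambda>x. (a j x)\<^sup>2)" "integrable M (\<lambda>x. (b x)\<^sup>2)"
    and lim: "(\<lambda>j. \<integral>x. (a j x)\<^sup>2 \<partial>M) \<longlonglongrightarrow> 0"
  shows "(\<lambda>j. \<integral>x. \<bar>a j x * b x\<bar> \<partial>M) \<longlonglongrightarrow> 0"
proof (rule tendsto_sandwich[where f = "\<lambda>_. 0"])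
  have "(\<integral>x. \<bar>a j x * b x\<bar> \<partial>M) \<le> sqrt ((\<integral>x. (a j x)\<^sup>2 \<partial>M) * (\<integral>x. (b x)\<^sup>2 \<partial>M))" for j
    using assms by (intro real_le_rsqrt Cauchy_Schwarz_integral) auto
  then show "\<forall>\<^sub>F j in sequentially. (\<integral>x. \<bar>a j x * b x\<bar> \<partial>M) \<le> sqrt ((\<integral>x. (a j x)\<^sup>2 \<partial>M) * (\<integral>x. (b x)\<^sup>2 \<partial>M))"
    by simp
  show "(\<lambda>j. sqrt ((\<integral>x. (a j x)\<^sup>2 \<partial>M) * (\<integral>x. (b x)\<^sup>2 \<partial>M))) \<longlonglongrightarrow> 0"
    using tendsto_real_sqrt[OF tendsto_mult_right[OF lim, of "\<integral>x. (b x)\<^sup>2 \<partial>M"]] by simp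
qed auto

text \<open>The square splits as (f - w)^2 + 2 (f - w) w + w^2, and the mixed term vanishes in the
  limit. For the second claim the constant 1 is square integrable, the measure being finite. These
  are the two limits needed to carry a Nash estimate from test functions to truncations.\<close>

lemma L2_convergence:
  fixes f :: "nat \<Rightarrow> 'a \<Rightarrow> real"
  assumes fin: "finite_measure M"
    and [measurable]: "\<And>j. f j \<in> borel_measurable M" "w \<in> borel_measurable M"
    and d: "\<And>j. integrable M (\<lambda>x. (f j x - w x)\<^sup>2)" and w: "integrable M (\<lambda>x. (w x)\<^sup>2)"
    and lim: "(\<lambda>j. \<integral>x. (f j x - w x)\<^sup>2 \<partial>M) \<longlonglongrightarrow> 0"
  shows "(\<lambda>j. \<integral>x. (f j x)\<^sup>2 \<partial>M) \<longlonglongrightarrow> (\<integral>x. (w x)\<^sup>2 \<partial>M)"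
    and "(\<lambda>j. \<integral>x. \<bar>f j x\<bar> \<partial>M) \<longlonglongrightarrow> (\<integral>x. \<bar>w x\<bar> \<partial>M)"
proof -
  interpret finite_measure M by fact
  have dw: "integrable M (\<lambda>x. (f j x - w x) * w x)" for j
    by (rule integrable_mult_L2) (use d w in auto)
  have "(\<lambda>j. \<integral>x. (f j x - w x) * w x \<partial>M) \<longlonglongrightarrow> 0"
  proof (rule Lim_null_comparison)
    show "\<forall>\<^sub>F j in sequentially. norm (\<integral>x. (f j x - w x) * w x \<partial>M) \<le> (\<integral>x. \<bar>(f j x - w x) * w x\<bar> \<partial>M)"
      by (simp add: integral_abs_bound)
  qed (rule L2_null_mult, use d w lim in auto)
  then have "(\<lambda>j. (\<integral>x. (f j x - w x)\<^sup>2 \<partial>M) + 2 * (\<integral>x. (f j x - w x) * w x \<partial>M) + (\<integral>x. (w x)\<^sup>2 \<partial>M))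
      \<longlonglongrightarrow> 0 + 2 * 0 + (\<integral>x. (w x)\<^sup>2 \<partial>M)"
    by (intro tendsto_intros lim)
  moreover have "(\<integral>x. (f j x - w x)\<^sup>2 \<partial>M) + 2 * (\<integral>x. (f j x - w x) * w x \<partial>M) + (\<integral>x. (w x)\<^sup>2 \<partial>M)
     = (\<integral>x. (f j x)\<^sup>2 \<partial>M)" for j
  proof -
    have "(\<integral>x. (f j x)\<^sup>2 \<partial>M) = (\<integral>x. (f j x - w x)\<^sup>2 + 2 * ((f j x - w x) * w x) + (w x)\<^sup>2 \<partial>M)"
      by (intro Bochner_Integration.integral_cong) (auto simp: power2_eq_square algebra_simps)
    then show ?thesis using d w dw by simp
  qed
  ultimately show "(\<lambda>j. \<integral>x. (f j x)\<^sup>2 \<partial>M) \<longlonglongrightarrow> (\<integral>x. (w x)\<^sup>2 \<partial>M)" by simp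
  have l1: "(\<lambda>j. \<integral>x. \<bar>f j x - w x\<bar> \<partial>M) \<longlonglongrightarrow> 0"
    using L2_null_mult[of "\<lambda>j x. f j x - w x" M "\<lambda>_. 1"] d lim by simp
  have id: "integrable M (\<lambda>x. f j x - w x)" for j
    using integrable_mult_L2[of "\<lambda>x. f j x - w x" M "\<lambda>_. 1"] d by simp
  have iw: "integrable M w"
    using integrable_mult_L2[of w M "\<lambda>_. 1"] w by simp
  have if': "integrable M (f j)" for j
    using Bochner_Integration.integrable_add[OF id[of j] iw] by simp
  have "norm ((\<integral>x. \<bar>f j x\<bar> \<partial>M) - (\<integral>x. \<bar>w x\<bar> \<partial>M)) \<le> (\<integral>x. \<bar>f j x - w x\<bar> \<partial>M)" for j
  proof -
    have "norm ((\<integral>x. \<bar>f j x\<bar> \<partial>M) - (\<integral>x. \<bar>w x\<bar> \<partial>M)) = \<bar>\<integral>x. \<bar>f j x\<bar> - \<bar>w x\<bar> \<partial>M\<bar>"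
      using iw if' by simp
    also have "\<dots> \<le> (\<integral>x. \<bar>\<bar>f j x\<bar> - \<bar>w x\<bar>\<bar> \<partial>M)" by (rule integral_abs_bound)
    also have "\<dots> \<le> (\<integral>x. \<bar>f j x - w x\<bar> \<partial>M)"
      using iw if' by (intro integral_mono) auto
    finally show ?thesis .
  qed
  then have "(\<lambda>j. (\<integral>x. \<bar>f j x\<bar> \<partial>M) - (\<integral>x. \<bar>w x\<bar> \<partial>M)) \<longlonglongrightarrow> 0"
    by (intro Lim_null_comparison[OF _ l1]) auto
  then show "(\<lambda>j. \<integral>x. \<bar>f j x\<bar> \<partial>M) \<longlonglongrightarrow> (\<integral>x. \<bar>w x\<bar> \<partial>M)"
    by (simp add: LIM_zero_iff)
qed

section \<open>Test functions and their \<open>H01\<close> limits on a domain of finite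
  measure\<close>

lemma finite_measure_lebesgue_on:
  assumes "\<Omega> \<in> sets lebesgue" "emeasure lebesgue \<Omega> < \<infinity>"
  shows "finite_measure (lebesgue_on \<Omega>)"
  using assms by (intro finite_measureI) (simp add: emeasure_restrict_space space_restrict_space)

lemma test_fun_measurable_lebesgue_on:
  fixes f :: "'a::euclidean_space \<Rightarrow> real"
  assumes "test_fun \<Omega> f"
  shows "f \<in> borel_measurable (lebesgue_on S)" "grad f \<in> borel_measurable (lebesgue_on S)"
proof -
  have "f \<in> borel_measurable lebesgue" "grad f \<in> borel_measurable lebesgue"
    using test_funD(2,3)[OF assms]
    by (auto intro!: measurable_completion borel_measurable_continuous_onI)
  then show "f \<in> borel_measurable (lebesgue_on S)" "grad f \<in> borel_measurable (lebesgue_on S)"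
    by (auto intro: measurable_restrict_space1)
qed

lemma test_fun_square_integrable:
  fixes f :: "'a::euclidean_space \<Rightarrow> real"
  assumes f: "test_fun \<Omega> f" and M: "\<Omega> \<in> sets lebesgue" "emeasure lebesgue \<Omega> < \<infinity>"
  shows "integrable (lebesgue_on \<Omega>) f" "integrable (lebesgue_on \<Omega>) (\<lambda>x. (f x)\<^sup>2)"
    "integrable (lebesgue_on \<Omega>) (\<lambda>x. (norm (grad f x))\<^sup>2)"
proof -
  interpret finite_measure "lebesgue_on \<Omega>" by (rule finite_measure_lebesgue_on[OF M])
  note [measurable] = test_fun_measurable_lebesgue_on[OF f]
  obtain B where B: "\<And>x. norm (f x) \<le> B" "\<And>x. norm (grad f x) \<le> B" 
    using test_fun_bounded[OF f] by blast
  show "integrable (lebesgue_on \<Omega>) f"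
    using B by (intro integrable_const_bound[of _ B]) auto
  show "integrable (lebesgue_on \<Omega>) (\<lambda>x. (f x)\<^sup>2)"
    using power_mono[OF B(1), where n = 2] by (intro integrable_const_bound[of _ "B\<^sup>2"]) auto
  show "integrable (lebesgue_on \<Omega>) (\<lambda>x. (norm (grad f x))\<^sup>2)"
    using power_mono[OF B(2), where n = 2] by (intro integrable_const_bound[of _ "B\<^sup>2"]) auto
qed

text \<open>Test functions and their gradients vanish off \<Omega> and are bounded, so the integrals
  over the whole space are finite and equal real integrals over \<Omega>.\<close>

lemma Nash_inequality:
  fixes f :: "'a::euclidean_space \<Rightarrow> real"
  assumes f: "test_fun \<Omega> f" and M: "\<Omega> \<in> sets lebesgue" "emeasure lebesgue \<Omega> < \<infinity>" and R: "R \<ge> 0"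
  defines "V \<equiv> measure lborel (ball (0::'a) R)"
  shows "2 * V * (\<integral>x. (f x)\<^sup>2 \<partial>lebesgue_on \<Omega>)
    \<le> V * R\<^sup>2 * (\<integral>x. (norm (grad f x))\<^sup>2 \<partial>lebesgue_on \<Omega>) + 2 * (\<integral>x. \<bar>f x\<bar> \<partial>lebesgue_on \<Omega>)\<^sup>2"
proof -
  note int = test_fun_square_integrable[OF f M]
  have on: "(\<integral>\<^sup>+x. ennreal (g x) \<partial>lborel) = ennreal (\<integral>x. g x \<partial>lebesgue_on \<Omega>)"
    if "\<And>x. x \<notin> \<Omega> \<Longrightarrow> g x = 0" "integrable (lebesgue_on \<Omega>) g" "\<And>x. g x \<ge> 0" for g :: "'a \<Rightarrow> real"
  proof -
    have "(\<integral>\<^sup>+x. ennreal (g x) \<partial>lborel) = (\<integral>\<^sup>+x. ennreal (g x) \<partial>lebesgue)"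
      by (simp add: nn_integral_completion)
    also have "\<dots> = (\<integral>\<^sup>+x. ennreal (g x) * indicator \<Omega> x \<partial>lebesgue)"
      by (intro nn_integral_cong) (use that(1) in \<open>auto split: split_indicator\<close>)
    also have "\<dots> = (\<integral>\<^sup>+x. ennreal (g x) \<partial>lebesgue_on \<Omega>)"
      using M by (simp add: nn_integral_restrict_space)
    also have "\<dots> = ennreal (\<integral>x. g x \<partial>lebesgue_on \<Omega>)"
      using that by (intro nn_integral_eq_integral) auto
    finally show ?thesis .
  qed
  have V: "emeasure lborel (ball (0::'a) R) = ennreal V"
    using emeasure_lborel_ball_finite[of "0::'a" R] unfolding V_def by (intro emeasure_eq_ennreal_measure) auto
  have V0: "V \<ge> 0" by (simp add: V_def)
  let ?S = "\<integral>x. (f x)\<^sup>2 \<partial>lebesgue_on \<Omega>" and ?D = "\<integral>x. (norm (grad f x))\<^sup>2 \<partial>lebesgue_on \<Omega>"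
    and ?L = "\<integral>x. \<bar>f x\<bar> \<partial>lebesgue_on \<Omega>"
  have e: "(\<integral>\<^sup>+x. ennreal ((f x)\<^sup>2) \<partial>lborel) = ennreal ?S"
    "(\<integral>\<^sup>+x. ennreal ((norm (grad f x))\<^sup>2) \<partial>lborel) = ennreal ?D"
    "(\<integral>\<^sup>+x. ennreal \<bar>f x\<bar> \<partial>lborel) = ennreal ?L"
    using int test_funD(4,5)[OF f] by (auto intro!: on)
  have "2 * (ennreal V * ennreal ?S) \<le> ennreal V * (ennreal (R\<^sup>2) * ennreal ?D) + 2 * (ennreal ?L)\<^sup>2"
    using Nash_inequality_nn[OF test_funD(1)[OF f] R] unfolding V e .
  moreover have "2 * (ennreal V * ennreal ?S) = ennreal (2 * V * ?S)"
    using V0 by (simp add: ennreal_mult mult.assoc)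
  moreover have "ennreal V * (ennreal (R\<^sup>2) * ennreal ?D) + 2 * (ennreal ?L)\<^sup>2 = ennreal (V * R\<^sup>2 * ?D + 2 * ?L\<^sup>2)"
    using V0 by (simp add: ennreal_mult ennreal_power mult.assoc)
  ultimately have "ennreal (2 * V * ?S) \<le> ennreal (V * R\<^sup>2 * ?D + 2 * ?L\<^sup>2)"
    by (simp only:)
  then show ?thesis
    by (subst (asm) ennreal_le_iff) (use V0 in auto)
qed

text \<open>The definition of \<open>H01\<close> speaks of extended integrals, which the limit 0
  makes finite only eventually. Discarding an initial segment makes every error finite, and a^2
  \<le> 2 (a - b)^2 + 2 b^2 then transfers square integrability from a test function to u and
  G.\<close>

lemma H01_approx:
  fixes u :: "'a::euclidean_space \<Rightarrow> real"
  assumes H: "H01 \<Omega> u G" and M: "\<Omega> \<in> sets lebesgue" "emeasure lebesgue \<Omega> < \<infinity>"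
  obtains \<phi> where "\<And>k. test_fun \<Omega> (\<phi> k)"
    "\<And>k. integrable (lebesgue_on \<Omega>) (\<lambda>x. (u x - \<phi> k x)\<^sup>2)"
    "(\<lambda>k. \<integral>x. (u x - \<phi> k x)\<^sup>2 \<partial>lebesgue_on \<Omega>) \<longlonglongrightarrow> 0"
    "\<And>k. integrable (lebesgue_on \<Omega>) (\<lambda>x. (norm (G x - grad (\<phi> k) x))\<^sup>2)"
    "(\<lambda>k. \<integral>x. (norm (G x - grad (\<phi> k) x))\<^sup>2 \<partial>lebesgue_on \<Omega>) \<longlonglongrightarrow> 0"
    "u \<in> borel_measurable (lebesgue_on \<Omega>)" "G \<in> borel_measurable (lebesgue_on \<Omega>)"
    "integrable (lebesgue_on \<Omega>) (\<lambda>x. (u x)\<^sup>2)" "integrable (lebesgue_on \<Omega>) (\<lambda>x. (norm (G x))\<^sup>2)"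
proof -
  have um[measurable]: "u \<in> borel_measurable (lebesgue_on \<Omega>)" and Gm[measurable]: "G \<in> borel_measurable (lebesgue_on \<Omega>)"
    using H by (auto simp: H01_def intro: measurable_restrict_space1)
  obtain \<phi> where t: "\<And>k. test_fun \<Omega> (\<phi> k)"
    and l1: "(\<lambda>k. \<integral>\<^sup>+ x\<in>\<Omega>. ennreal ((u x - \<phi> k x)\<^sup>2) \<partial>lebesgue) \<longlonglongrightarrow> 0"
    and l2: "(\<lambda>k. \<integral>\<^sup>+ x\<in>\<Omega>. ennreal ((norm (G x - grad (\<phi> k) x))\<^sup>2) \<partial>lebesgue) \<longlonglongrightarrow> 0"
    using H unfolding H01_def by blast
  note [measurable] = test_fun_measurable_lebesgue_on[OF t]
  have L: "\<exists>N. (\<forall>k\<ge>N. integrable (lebesgue_on \<Omega>) (g k)) \<and> (\<lambda>k. \<integral>x. g (k + N) x \<partial>lebesgue_on \<Omega>) \<longlonglongrightarrow> 0"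
    if l: "(\<lambda>k. \<integral>\<^sup>+ x\<in>\<Omega>. ennreal (g k x) \<partial>lebesgue) \<longlonglongrightarrow> 0"
      and g[measurable]: "\<And>k. g k \<in> borel_measurable (lebesgue_on \<Omega>)" and g0: "\<And>k x. g k x \<ge> 0"
    for g :: "nat \<Rightarrow> 'a \<Rightarrow> real"
  proof -
    have "\<forall>\<^sub>F k in sequentially. (\<integral>\<^sup>+ x\<in>\<Omega>. ennreal (g k x) \<partial>lebesgue) < 1"
      using order_tendstoD(2)[OF l, of 1] by simp
    then obtain N where N: "\<And>k. k \<ge> N \<Longrightarrow> (\<integral>\<^sup>+ x\<in>\<Omega>. ennreal (g k x) \<partial>lebesgue) < 1"
      by (auto simp: eventually_sequentially)
    have eq: "(\<integral>\<^sup>+ x\<in>\<Omega>. ennreal (g k x) \<partial>lebesgue) = (\<integral>\<^sup>+ x. ennreal (g k x) \<partial>lebesgue_on \<Omega>)" for k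
      using M by (simp add: nn_integral_restrict_space)
    have i: "integrable (lebesgue_on \<Omega>) (g k)" if "k \<ge> N" for k
      using N[OF that] g0 unfolding eq
      by (intro integrableI_nonneg) (auto intro: less_trans)
    have "(\<lambda>k. \<integral>\<^sup>+ x\<in>\<Omega>. ennreal (g (k + N) x) \<partial>lebesgue) \<longlonglongrightarrow> 0"
      using LIMSEQ_ignore_initial_segment[OF l, of N] .
    moreover have "(\<integral>\<^sup>+ x\<in>\<Omega>. ennreal (g (k + N) x) \<partial>lebesgue) = ennreal (\<integral>x. g (k + N) x \<partial>lebesgue_on \<Omega>)" for k
      unfolding eq using i[of "k + N"] g0 by (intro nn_integral_eq_integral) auto
    ultimately have "(\<lambda>k. ennreal (\<integral>x. g (k + N) x \<partial>lebesgue_on \<Omega>)) \<longlonglongrightarrow> ennreal 0"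
      by simp
    then have "(\<lambda>k. \<integral>x. g (k + N) x \<partial>lebesgue_on \<Omega>) \<longlonglongrightarrow> 0"
      using g0 by (subst (asm) tendsto_ennreal_iff) auto
    then show ?thesis using i by blast
  qed
  obtain N1 where N1: "\<And>k. k\<ge>N1 \<Longrightarrow> integrable (lebesgue_on \<Omega>) (\<lambda>x. (u x - \<phi> k x)\<^sup>2)"
     "(\<lambda>k. \<integral>x. (u x - \<phi> (k + N1) x)\<^sup>2 \<partial>lebesgue_on \<Omega>) \<longlonglongrightarrow> 0"
    using L[OF l1] by auto
  obtain N2 where N2: "\<And>k. k\<ge>N2 \<Longrightarrow> integrable (lebesgue_on \<Omega>) (\<lambda>x. (norm (G x - grad (\<phi> k) x))\<^sup>2)"
     "(\<lambda>k. \<integral>x. (norm (G x - grad (\<phi> (k + N2)) x))\<^sup>2 \<partial>lebesgue_on \<Omega>) \<longlonglongrightarrow> 0"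
    using L[OF l2] by auto
  note ii = N1(1)[of "N1 + N2"] N2(1)[of "N1 + N2"] test_fun_square_integrable[OF t M]
  have "integrable (lebesgue_on \<Omega>) (\<lambda>x. (u x)\<^sup>2)"
  proof (rule Bochner_Integration.integrable_bound)
    show "integrable (lebesgue_on \<Omega>) (\<lambda>x. 2 * (u x - \<phi> (N1 + N2) x)\<^sup>2 + 2 * (\<phi> (N1 + N2) x)\<^sup>2)"
      using ii by simp
    show "AE x in lebesgue_on \<Omega>. norm ((u x)\<^sup>2) \<le> norm (2 * (u x - \<phi> (N1 + N2) x)\<^sup>2 + 2 * (\<phi> (N1 + N2) x)\<^sup>2)"
    proof (rule AE_I2)
      fix x
      have "0 \<le> (u x - 2 * \<phi> (N1 + N2) x)\<^sup>2" by simp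
      then show "norm ((u x)\<^sup>2) \<le> norm (2 * (u x - \<phi> (N1 + N2) x)\<^sup>2 + 2 * (\<phi> (N1 + N2) x)\<^sup>2)"
        by (simp add: power2_eq_square algebra_simps)
    qed
  qed simp
  moreover have "integrable (lebesgue_on \<Omega>) (\<lambda>x. (norm (G x))\<^sup>2)"
  proof (rule Bochner_Integration.integrable_bound)
    show "integrable (lebesgue_on \<Omega>) (\<lambda>x. 2 * (norm (G x - grad (\<phi> (N1 + N2)) x))\<^sup>2 + 2 * (norm (grad (\<phi> (N1 + N2)) x))\<^sup>2)"
      using ii by simp
    show "AE x in lebesgue_on \<Omega>. norm ((norm (G x))\<^sup>2) \<le>
      norm (2 * (norm (G x - grad (\<phi> (N1 + N2)) x))\<^sup>2 + 2 * (norm (grad (\<phi> (N1 + N2)) x))\<^sup>2)"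
    proof (rule AE_I2)
      fix x
      let ?a = "G x" and ?b = "grad (\<phi> (N1 + N2)) x"
      have "0 \<le> (norm (?a - 2 *\<^sub>R ?b))\<^sup>2" by simp
      then show "norm ((norm ?a)\<^sup>2) \<le> norm (2 * (norm (?a - ?b))\<^sup>2 + 2 * (norm ?b)\<^sup>2)"
        by (simp add: power2_norm_eq_inner algebra_simps inner_commute)
    qed
  qed simp
  moreover have "(\<lambda>k. \<integral>x. (u x - \<phi> (k + (N1 + N2)) x)\<^sup>2 \<partial>lebesgue_on \<Omega>) \<longlonglongrightarrow> 0"
    "(\<lambda>k. \<integral>x. (norm (G x - grad (\<phi> (k + (N1 + N2))) x))\<^sup>2 \<partial>lebesgue_on \<Omega>) \<longlonglongrightarrow> 0"
    using LIMSEQ_ignore_initial_segment[OF N1(2), of N2] LIMSEQ_ignore_initial_segment[OF N2(2), of N1]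
    by (simp_all add: add_ac)
  ultimately show ?thesis
    using that[of "\<lambda>k. \<phi> (k + (N1 + N2))"] t N1(1) N2(1) um Gm by simp
qed

section \<open>Completeness and the minimisation of quadratic energies\<close>

lemma L2_complete:
  fixes f :: "nat \<Rightarrow> 'a \<Rightarrow> 'b::euclidean_space"
  assumes [measurable]: "\<And>n. f n \<in> borel_measurable M"
    and cauchy: "\<And>e. e > 0 \<Longrightarrow>
      \<exists>N. \<forall>m\<ge>N. \<forall>n\<ge>N. (\<integral>\<^sup>+x. ennreal ((norm (f m x - f n x))\<^sup>2) \<partial>M) \<le> ennreal e"
  shows "\<exists>g\<in>borel_measurable M. (\<lambda>n. \<integral>\<^sup>+x. ennreal ((norm (g x - f n x))\<^sup>2) \<partial>M) \<longlonglongrightarrow> 0"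
proof -
  \<comment> \<open>The Riesz-Fischer argument. The rate 8^-k beats the weight 4^k used below: the
    weighted sum of squared increments has finite integral, so it is finite almost everywhere, and
    there the increments are bounded by a multiple of 2^-k.\<close>
  have "\<forall>k. \<exists>N. \<forall>m\<ge>N. \<forall>n\<ge>N.
      (\<integral>\<^sup>+x. ennreal ((norm (f m x - f n x))\<^sup>2) \<partial>M) \<le> ennreal ((1 / 8) ^ k)"
    using cauchy by simp
  then obtain N where N: "\<And>k m n. m \<ge> N k \<Longrightarrow> n \<ge> N k \<Longrightarrow>
      (\<integral>\<^sup>+x. ennreal ((norm (f m x - f n x))\<^sup>2) \<partial>M) \<le> ennreal ((1 / 8) ^ k)"
    by metis
  \<comment> \<open>A partial sum of the thresholds dominates all of them up to k.\<close>
  define r where "r k = (\<Sum>i\<le>k. N i)" for k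
  have r: "N j \<le> r k" if "j \<le> k" for j k
    unfolding r_def using that by (intro member_le_sum) auto
  define F where "F k = f (r k)" for k
  have [measurable]: "F k \<in> borel_measurable M" for k by (simp add: F_def)
  \<comment> \<open>Where the sequence diverges, \<open>lim\<close> is an unspecified value; this
    happens only on a null set.\<close>
  define g where "g x = lim (\<lambda>k. F k x)" for x
  have g[measurable]: "g \<in> borel_measurable M"
    unfolding g_def by (intro borel_measurable_lim_metric) simp
  have "(\<integral>\<^sup>+x. (\<Sum>k. ennreal (4 ^ k * (norm (F (Suc k) x - F k x))\<^sup>2)) \<partial>M)
      = (\<Sum>k. \<integral>\<^sup>+x. ennreal (4 ^ k * (norm (F (Suc k) x - F k x))\<^sup>2) \<partial>M)"
    by (rule nn_integral_suminf) simp
  also have "\<dots> \<le> (\<Sum>k. ennreal ((1 / 2) ^ k))"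
  proof (rule suminf_le)
    fix k
    have "(\<integral>\<^sup>+x. ennreal (4 ^ k * (norm (F (Suc k) x - F k x))\<^sup>2) \<partial>M)
        = ennreal (4 ^ k) * (\<integral>\<^sup>+x. ennreal ((norm (F (Suc k) x - F k x))\<^sup>2) \<partial>M)"
      by (simp add: ennreal_mult nn_integral_cmult)
    also have "\<dots> \<le> ennreal (4 ^ k) * ennreal ((1 / 8) ^ k)"
      unfolding F_def by (intro mult_left_mono N r) auto
    also have "\<dots> = ennreal ((1 / 2) ^ k)"
      by (simp add: ennreal_mult[symmetric] power_mult_distrib[symmetric])
    finally show "(\<integral>\<^sup>+x. ennreal (4 ^ k * (norm (F (Suc k) x - F k x))\<^sup>2) \<partial>M) \<le> ennreal ((1 / 2) ^ k)" .
  qed auto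
  also have "\<dots> = ennreal (\<Sum>k. (1 / 2) ^ k)"
    by (rule suminf_ennreal2) (auto intro: summable_geometric)
  finally have "(\<integral>\<^sup>+x. (\<Sum>k. ennreal (4 ^ k * (norm (F (Suc k) x - F k x))\<^sup>2)) \<partial>M) \<noteq> \<infinity>"
    by (auto simp: top_unique)
  then have "AE x in M. (\<Sum>k. ennreal (4 ^ k * (norm (F (Suc k) x - F k x))\<^sup>2)) \<noteq> \<infinity>"
    by (rule nn_integral_noteq_infinite[rotated]) measurable
  then have conv: "AE x in M. (\<lambda>k. F k x) \<longlonglongrightarrow> g x"
  proof eventually_elim
    fix x
    assume fin: "(\<Sum>k. ennreal (4 ^ k * (norm (F (Suc k) x - F k x))\<^sup>2)) \<noteq> \<infinity>"
    have "\<exists>S\<ge>0. y = ennreal S" if "y \<noteq> \<infinity>" for y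
      using that by (cases y) auto
    from this[OF fin] obtain S
      where S: "S \<ge> 0" "(\<Sum>k. ennreal (4 ^ k * (norm (F (Suc k) x - F k x))\<^sup>2)) = ennreal S"
      by blast
    have d: "norm (F (Suc k) x - F k x) \<le> sqrt S * (1 / 2) ^ k" for k
    proof -
      have "(\<Sum>i\<in>{k}. ennreal (4 ^ i * (norm (F (Suc i) x - F i x))\<^sup>2)) \<le> ennreal S"
        unfolding S(2)[symmetric] by (rule sum_le_suminf) auto
      then have "4 ^ k * (norm (F (Suc k) x - F k x))\<^sup>2 \<le> S"
        using S(1) by (simp add: ennreal_le_iff)
      also have "4 ^ k * (norm (F (Suc k) x - F k x))\<^sup>2 = (2 ^ k * norm (F (Suc k) x - F k x))\<^sup>2"
        by (simp add: power_mult_distrib power_mult[symmetric] mult.commute[of k] power_mult)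
      finally have "(2 ^ k * norm (F (Suc k) x - F k x))\<^sup>2 \<le> S" .
      then have "2 ^ k * norm (F (Suc k) x - F k x) \<le> sqrt S"
        by (rule real_le_rsqrt)
      then show ?thesis by (simp add: field_simps power_one_over)
    qed
    have "summable (\<lambda>k. F (Suc k) x - F k x)"
      by (rule summable_comparison_test'[where N = 0 and g = "\<lambda>k. sqrt S * (1 / 2) ^ k"])
        (auto intro!: summable_mult summable_geometric d)
    then have "convergent (\<lambda>n. \<Sum>k<n. (F (Suc k) x - F k x))"
      by (simp add: summable_iff_convergent)
    then have "convergent (\<lambda>n. F n x - F 0 x)"
      by (simp add: sum_lessThan_telescope[of "\<lambda>n. F n x"])
    then have "convergent (\<lambda>n. F n x)"
      using convergent_add[OF _ convergent_const[of "F 0 x"]] by fastforce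
    then show "(\<lambda>k. F k x) \<longlonglongrightarrow> g x"
      unfolding g_def by (simp add: convergent_LIMSEQ_iff)
  qed
  \<comment> \<open>Fatou along the subsequence estimates the distance of the limit from every late
    f n, not just from members of the subsequence.\<close>
  have bound: "(\<integral>\<^sup>+x. ennreal ((norm (g x - f n x))\<^sup>2) \<partial>M) \<le> ennreal ((1 / 8) ^ j)" if n: "n \<ge> N j" for n j
  proof -
    have "(\<integral>\<^sup>+x. ennreal ((norm (g x - f n x))\<^sup>2) \<partial>M)
        = (\<integral>\<^sup>+x. liminf (\<lambda>k. ennreal ((norm (F k x - f n x))\<^sup>2)) \<partial>M)"
    proof (rule nn_integral_cong_AE, use conv in eventually_elim)
      fix x assume "(\<lambda>k. F k x) \<longlonglongrightarrow> g x"
      then have "(\<lambda>k. ennreal ((norm (F k x - f n x))\<^sup>2)) \<longlonglongrightarrow> ennreal ((norm (g x - f n x))\<^sup>2)"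
        by (intro tendsto_intros)
      then show "ennreal ((norm (g x - f n x))\<^sup>2) = liminf (\<lambda>k. ennreal ((norm (F k x - f n x))\<^sup>2))"
        by (intro lim_imp_Liminf[symmetric]) auto
    qed
    also have "\<dots> \<le> liminf (\<lambda>k. \<integral>\<^sup>+x. ennreal ((norm (F k x - f n x))\<^sup>2) \<partial>M)"
      by (rule nn_integral_liminf) simp
    also have "\<dots> \<le> liminf (\<lambda>k. ennreal ((1 / 8) ^ j))"
    proof (rule Liminf_mono)
      show "\<forall>\<^sub>F k in sequentially. (\<integral>\<^sup>+x. ennreal ((norm (F k x - f n x))\<^sup>2) \<partial>M) \<le> ennreal ((1 / 8) ^ j)"
        unfolding F_def using eventually_ge_at_top[of j] by eventually_elim (intro N r n)
    qed
    finally show ?thesis by (simp add: Liminf_const)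
  qed
  have "(\<lambda>n. \<integral>\<^sup>+x. ennreal ((norm (g x - f n x))\<^sup>2) \<partial>M) \<longlonglongrightarrow> 0"
  proof (rule order_tendstoI)
    fix a :: ennreal
    assume "0 < a"
    then obtain e where e: "0 < e" "ennreal e < a"
    proof (cases a)
      case (real r)
      then show ?thesis using \<open>0 < a\<close> that[of "r / 2"] by (auto simp: ennreal_less_iff)
    next
      case top
      then show ?thesis using that[of 1] by auto
    qed
    obtain j where "(1 / 8) ^ j < e"
      using real_arch_pow_inv[OF e(1), of "1 / 8"] by auto
    then have j: "ennreal ((1 / 8) ^ j) < a"
      using e(2) by (meson ennreal_leI le_less_trans less_imp_le)
    show "\<forall>\<^sub>F n in sequentially. (\<integral>\<^sup>+x. ennreal ((norm (g x - f n x))\<^sup>2) \<partial>M) < a"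
      using eventually_ge_at_top[of "N j"] by eventually_elim (use bound j le_less_trans in blast)
  qed simp
  then show ?thesis using g by blast
qed

text \<open>Dirichlet principle with the passage to the limit left out: E/2 - l is bounded below,
  and any minimising sequence is Cauchy for E and solves the Euler equation asymptotically. The
  polar form \<open>a\<close> is known through the expansion of E along lines.\<close>

lemma quadratic_minimizing_sequence:
  fixes T :: "('a \<Rightarrow> real) set" and E l :: "('a \<Rightarrow> real) \<Rightarrow> real" and a :: "('a \<Rightarrow> real) \<Rightarrow> ('a \<Rightarrow> real) \<Rightarrow> real"
  assumes ne: "T \<noteq> {}" and cl: "\<And>u w t. u \<in> T \<Longrightarrow> w \<in> T \<Longrightarrow> (\<lambda>x. u x + t * w x) \<in> T"
    and E: "\<And>u w t. u \<in> T \<Longrightarrow> w \<in> T \<Longrightarrow> E (\<lambda>x. u x + t * w x) = E u + 2 * t * a u w + t\<^sup>2 * E w"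
    and l: "\<And>u w t. u \<in> T \<Longrightarrow> w \<in> T \<Longrightarrow> l (\<lambda>x. u x + t * w x) = l u + t * l w"
    and E0: "\<And>u. u \<in> T \<Longrightarrow> E u \<ge> 0" and C: "\<And>u. u \<in> T \<Longrightarrow> (l u)\<^sup>2 \<le> C * E u" "C \<ge> 0"
  obtains s where "\<And>n. s n \<in> T" 
    "\<And>m n. E (\<lambda>x. s m x - s n x) \<le> 4 * (1 / real (Suc m) + 1 / real (Suc n))"
    "\<And>w. w \<in> T \<Longrightarrow> (\<lambda>n. a (s n) w) \<longlonglongrightarrow> l w"
proof -
  define J where "J u = E u / 2 - l u" for u
  have J: "J (\<lambda>x. u x + t * w x) = J u + t * (a u w - l w) + t\<^sup>2 / 2 * E w" if "u \<in> T" "w \<in> T" for u w t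
    using that by (simp add: J_def E l field_simps)
  have lb: "- C / 2 \<le> J u" if u: "u \<in> T" for u
  proof -
    \<comment> \<open>Arithmetic-geometric mean: \<bar>l u\<bar> \<le> (C + E u)/2, so half the
      energy absorbs the linear term up to C/2.\<close>
    have "4 * (C * E u) \<le> (C + E u)\<^sup>2"
      using zero_le_power2[of "C - E u"] by (simp add: power2_eq_square algebra_simps)
    then have "(l u)\<^sup>2 \<le> ((C + E u) / 2)\<^sup>2"
      using C(1)[OF u] by (simp add: power_divide)
    then have "l u \<le> (C + E u) / 2"
      using C(2) E0[OF u] by (intro power2_le_imp_le[of "l u"]) auto
    then show ?thesis by (simp add: J_def field_simps)
  qed
  define I where "I = Inf (J ` T)"
  have bdd: "bdd_below (J ` T)" using lb by (intro bdd_belowI2)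
  have I: "I \<le> J u" if "u \<in> T" for u
    unfolding I_def using that bdd by (intro cInf_lower) auto
  have "\<exists>u\<in>T. J u < I + 1 / real (Suc n)" for n
    using cInf_less_iff[of "J ` T" "I + 1 / real (Suc n)"] ne bdd unfolding I_def by auto
  then obtain s where s: "\<And>n. s n \<in> T" "\<And>n. J (s n) < I + 1 / real (Suc n)"
    by metis
  have "E (\<lambda>x. s m x - s n x) \<le> 4 * (1 / real (Suc m) + 1 / real (Suc n))" for m n
  proof -
    \<comment> \<open>By the parallelogram law the midpoint of s m and s n has J equal to the mean
      of the two end values minus E d / 8. It is still at least I, while the ends exceed I by less
      than 1/(m+1) and 1/(n+1); hence the factor 4.\<close>
    define d where "d = (\<lambda>x. s m x + (- 1) * s n x)"
    have d: "d \<in> T" unfolding d_def using s by (intro cl)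
    have "J (\<lambda>x. s m x + (- 1) * d x) = J (s m) + (- 1) * (a (s m) d - l d) + (- 1)\<^sup>2 / 2 * E d"
      by (intro J s d)
    moreover have "(\<lambda>x. s m x + (- 1) * d x) = s n" by (auto simp: d_def)
    moreover have "J (\<lambda>x. s m x + (- 1 / 2) * d x) = J (s m) + (- 1 / 2) * (a (s m) d - l d) + (- 1 / 2)\<^sup>2 / 2 * E d"
      by (intro J s d)
    moreover have "I \<le> J (\<lambda>x. s m x + (- 1 / 2) * d x)"
      by (intro I cl s d)
    ultimately have "J (s n) = J (s m) - (a (s m) d - l d) + E d / 2"
      "I \<le> J (s m) - (a (s m) d - l d) / 2 + E d / 8"
      by (auto simp: power2_eq_square)
    with s(2)[of m] s(2)[of n] have "E d \<le> 4 * (1 / real (Suc m) + 1 / real (Suc n))"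
      by argo
    then show ?thesis by (simp add: d_def)
  qed
  moreover have "(\<lambda>n. a (s n) w) \<longlonglongrightarrow> l w" if w: "w \<in> T" for w
  proof -
    \<comment> \<open>Adding 1 allows division by c even when w has energy 0.\<close>
    define c where "c = E w + 1"
    have c: "c > 0" "E w \<le> c" using E0[OF w] by (auto simp: c_def)
    have "(a (s n) w - l w)\<^sup>2 \<le> 2 * c * (1 / real (Suc n))" for n
    proof -
      define X where "X = a (s n) w - l w"
      \<comment> \<open>This t minimises t X + t^2 c / 2, with minimum -X^2 / (2c); near-minimality
        of s n therefore forces X to be small.\<close>
      define t where "t = - X / c"
      have "I \<le> J (s n) + t * X + t\<^sup>2 / 2 * E w"
        using I[OF cl[OF s(1)[of n] w, of t]] J[OF s(1)[of n] w, of t] by (simp add: X_def)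
      also have "\<dots> \<le> J (s n) + t * X + t\<^sup>2 / 2 * c"
        using c by (intro add_left_mono mult_left_mono) auto
      also have "\<dots> = J (s n) - X\<^sup>2 / (2 * c)"
        using c(1) by (simp add: t_def power2_eq_square field_simps)
      finally have "X\<^sup>2 / (2 * c) \<le> 1 / real (Suc n)"
        using s(2)[of n] by simp
      then have "X\<^sup>2 \<le> (1 / real (Suc n)) * (2 * c)"
        using c(1) by (subst (asm) pos_divide_le_eq) auto
      then show ?thesis by (simp add: X_def mult.commute)
    qed
    then have le: "\<forall>\<^sub>F n in sequentially. (a (s n) w - l w)\<^sup>2 \<le> 2 * c * (1 / real (Suc n))"
      by (intro always_eventually allI)
    have "(\<lambda>n. 2 * c * (1 / real (Suc n))) \<longlonglongrightarrow> 0"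
      using tendsto_mult_right_zero[OF LIMSEQ_Suc[OF lim_1_over_n]] by blast
    then have "(\<lambda>n. (a (s n) w - l w)\<^sup>2) \<longlonglongrightarrow> 0"
      by (intro tendsto_sandwich[OF _ le tendsto_const[of 0]]) auto
    then have "(\<lambda>n. sqrt ((a (s n) w - l w)\<^sup>2)) \<longlonglongrightarrow> sqrt 0"
      by (rule tendsto_real_sqrt)
    then have "(\<lambda>n. a (s n) w - l w) \<longlonglongrightarrow> 0"
      by (simp add: tendsto_rabs_zero_iff)
    then show ?thesis by (simp add: LIM_zero_iff)
  qed
  ultimately show ?thesis using that s(1) by blast
qed

section \<open>Volumes of balls and the Poincare inequality\<close>

lemma ball_radius_of_volume:
  obtains c where "c > 0" "\<And>b. b > 0 \<Longrightarrow>
    measure lborel (ball (0::'a::euclidean_space) (c * b powr (1 / DIM('a)))) = b"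
proof -
  define w where "w = measure lborel (ball (0::'a) 1)"
  have w: "w > 0" unfolding w_def using content_ball_pos[of 1 "0::'a"] by simp
  \<comment> \<open>The radius of the ball of volume 1. Writing the radius as an explicit power of
    the volume is what later makes the level increments geometric.\<close>
  define c where "c = (1 / w) powr (1 / DIM('a))"
  have c: "c > 0" using w by (simp add: c_def)
  have cp: "(x powr (1 / DIM('a))) ^ DIM('a) = x" if "x > 0" for x
    using that by (simp add: powr_realpow[symmetric] powr_powr)
  have "measure lborel (ball (0::'a) (c * b powr (1 / DIM('a)))) = b" if "b > 0" for b
  proof -
    have "measure lborel (ball (0::'a) (c * b powr (1 / DIM('a)))) = (c * b powr (1 / DIM('a))) ^ DIM('a) * w"
      unfolding w_def using c by (subst content_ball_conv_unit_ball) auto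
    also have "\<dots> = b"
      unfolding power_mult_distrib c_def using that w by (simp add: cp)
    finally show ?thesis .
  qed
  then show ?thesis using that c by blast
qed

lemma integral_abs_square_le:
  fixes f :: "'a \<Rightarrow> real"
  assumes "finite_measure M" "f \<in> borel_measurable M" "integrable M (\<lambda>x. (f x)\<^sup>2)"
  shows "(\<integral>x. \<bar>f x\<bar> \<partial>M)\<^sup>2 \<le> measure M (space M) * (\<integral>x. (f x)\<^sup>2 \<partial>M)"
proof -
  interpret finite_measure M by fact
  show ?thesis
    using Cauchy_Schwarz_integral[of f M "\<lambda>_. 1"] assms by (simp add: mult.commute)
qed

lemma Poincare_inequality:
  assumes M: "\<Omega> \<in> sets lebesgue" "0 < emeasure lebesgue \<Omega>" "emeasure lebesgue \<Omega> < \<infinity>"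
  obtains C where "C \<ge> 0" "\<And>f :: 'a::euclidean_space \<Rightarrow> real. test_fun \<Omega> f \<Longrightarrow>
    (\<integral>x. (f x)\<^sup>2 \<partial>lebesgue_on \<Omega>) \<le> C * (\<integral>x. (norm (grad f x))\<^sup>2 \<partial>lebesgue_on \<Omega>)"
proof -
  define m where "m = measure (lebesgue_on \<Omega>) (space (lebesgue_on \<Omega>))"
  have "m = measure lebesgue \<Omega>"
    using M(1) by (simp add: m_def measure_restrict_space space_restrict_space)
  then have "ennreal m = emeasure lebesgue \<Omega>"
    using M(3) emeasure_eq_ennreal_measure[of lebesgue \<Omega>] by (metis infinity_ennreal_def less_irrefl)
  then have m: "m > 0"
    using M(2) by (metis ennreal_eq_0_iff less_irrefl not_le)
  obtain c where c: "c > 0" "\<And>b. b > 0 \<Longrightarrow> measure lborel (ball (0::'a) (c * b powr (1 / DIM('a)))) = b"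
    using ball_radius_of_volume[where 'a = 'a] by blast
  define R where "R = c * (2 * m) powr (1 / DIM('a))"
  have R: "R \<ge> 0" "measure lborel (ball (0::'a) R) = 2 * m"
    using c m by (auto simp: R_def)
  have "(\<integral>x. (f x)\<^sup>2 \<partial>lebesgue_on \<Omega>) \<le> R\<^sup>2 * (\<integral>x. (norm (grad f x))\<^sup>2 \<partial>lebesgue_on \<Omega>)"
    if f: "test_fun \<Omega> f" for f :: "'a \<Rightarrow> real"
  proof -
    \<comment> \<open>With a ball of volume 2m the Nash inequality has 4m times the integral of f^2
      on the left, and this bound lets 2m of it absorb the L1 term. What remains gives the constant
      R^2.\<close>
    have "(\<integral>x. \<bar>f x\<bar> \<partial>lebesgue_on \<Omega>)\<^sup>2 \<le> m * (\<integral>x. (f x)\<^sup>2 \<partial>lebesgue_on \<Omega>)"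
      unfolding m_def using M f
      by (intro integral_abs_square_le finite_measure_lebesgue_on test_fun_measurable_lebesgue_on test_fun_square_integrable) auto
    with Nash_inequality[OF f M(1,3) R(1)]
    have "(2 * m) * (\<integral>x. (f x)\<^sup>2 \<partial>lebesgue_on \<Omega>) \<le> (2 * m) * (R\<^sup>2 * (\<integral>x. (norm (grad f x))\<^sup>2 \<partial>lebesgue_on \<Omega>))"
      unfolding R(2) by (simp add: mult_ac)
    then show ?thesis using m by simp
  qed
  then show ?thesis using that[of "R\<^sup>2"] by auto
qed

section \<open>Existence of the torsion function\<close>

lemma set_integral_eq_lebesgue_on:
  fixes f :: "'a::euclidean_space \<Rightarrow> real"
  assumes "\<Omega> \<in> sets lebesgue"
  shows "(LINT x:\<Omega>|lebesgue. f x) = (\<integral>x. f x \<partial>lebesgue_on \<Omega>)"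
  using assms by (simp add: set_lebesgue_integral_def integral_restrict_space)

lemma integrable_inner_L2:
  fixes F H :: "'a \<Rightarrow> 'b::euclidean_space"
  assumes [measurable]: "F \<in> borel_measurable M" "H \<in> borel_measurable M"
    and F: "integrable M (\<lambda>x. (norm (F x))\<^sup>2)" and H: "integrable M (\<lambda>x. (norm (H x))\<^sup>2)"
  shows "integrable M (\<lambda>x. F x \<bullet> H x)"
proof (rule Bochner_Integration.integrable_bound)
  show "integrable M (\<lambda>x. norm (F x) * norm (H x))"
    by (rule integrable_mult_L2) (use F H in auto)
  show "AE x in M. norm (F x \<bullet> H x) \<le> norm (norm (F x) * norm (H x))"
    by (simp add: Cauchy_Schwarz_ineq2)
qed simp

lemma integrable_norm_diff_L2:
  fixes F H :: "'a \<Rightarrow> 'b::euclidean_space"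
  assumes [measurable]: "F \<in> borel_measurable M" "H \<in> borel_measurable M"
    and F: "integrable M (\<lambda>x. (norm (F x))\<^sup>2)" and H: "integrable M (\<lambda>x. (norm (H x))\<^sup>2)"
  shows "integrable M (\<lambda>x. (norm (F x - H x))\<^sup>2)"
proof -
  have "integrable M (\<lambda>x. (norm (F x))\<^sup>2 + (norm (H x))\<^sup>2 - 2 * (F x \<bullet> H x))"
    using F H integrable_inner_L2[OF assms] by simp
  then show ?thesis
    by (rule Bochner_Integration.integrable_cong[THEN iffD1, rotated -1])
      (auto simp: power2_norm_eq_inner algebra_simps inner_commute)
qed

lemma inner_L2_tendsto:
  fixes F :: "nat \<Rightarrow> 'a \<Rightarrow> 'b::euclidean_space"
  assumes [measurable]: "\<And>n. F n \<in> borel_measurable M" "G \<in> borel_measurable M" "H \<in> borel_measurable M"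
    and F: "\<And>n. integrable M (\<lambda>x. (norm (F n x))\<^sup>2)" and G: "integrable M (\<lambda>x. (norm (G x))\<^sup>2)"
    and H: "integrable M (\<lambda>x. (norm (H x))\<^sup>2)"
    and lim: "(\<lambda>n. \<integral>x. (norm (G x - F n x))\<^sup>2 \<partial>M) \<longlonglongrightarrow> 0"
  shows "(\<lambda>n. \<integral>x. F n x \<bullet> H x \<partial>M) \<longlonglongrightarrow> (\<integral>x. G x \<bullet> H x \<partial>M)"
proof -
  have d: "integrable M (\<lambda>x. (norm (G x - F n x))\<^sup>2)" for n
    by (rule integrable_norm_diff_L2) (use F G in auto)
  have l: "(\<lambda>n. \<integral>x. \<bar>norm (G x - F n x) * norm (H x)\<bar> \<partial>M) \<longlonglongrightarrow> 0"
    by (rule L2_null_mult) (use d H lim in auto)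
  have "norm ((\<integral>x. F n x \<bullet> H x \<partial>M) - (\<integral>x. G x \<bullet> H x \<partial>M)) \<le> (\<integral>x. \<bar>norm (G x - F n x) * norm (H x)\<bar> \<partial>M)" for n
  proof -
    have i: "integrable M (\<lambda>x. F n x \<bullet> H x)" "integrable M (\<lambda>x. G x \<bullet> H x)"
      "integrable M (\<lambda>x. norm (G x - F n x) * norm (H x))"
      using F G H d by (auto intro: integrable_inner_L2 integrable_mult_L2)
    have "norm ((\<integral>x. F n x \<bullet> H x \<partial>M) - (\<integral>x. G x \<bullet> H x \<partial>M)) = \<bar>\<integral>x. F n x \<bullet> H x - G x \<bullet> H x \<partial>M\<bar>"
      using i by simp
    also have "\<dots> \<le> (\<integral>x. \<bar>F n x \<bullet> H x - G x \<bullet> H x\<bar> \<partial>M)" by (rule integral_abs_bound)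
    also have "\<dots> \<le> (\<integral>x. \<bar>norm (G x - F n x) * norm (H x)\<bar> \<partial>M)"
    proof (rule integral_mono)
      show "\<bar>F n x \<bullet> H x - G x \<bullet> H x\<bar> \<le> \<bar>norm (G x - F n x) * norm (H x)\<bar>" for x
        using Cauchy_Schwarz_ineq2[of "F n x - G x" "H x"]
        by (simp add: inner_diff_left norm_minus_commute)
    qed (use i in auto)
    finally show ?thesis .
  qed
  then have "(\<lambda>n. (\<integral>x. F n x \<bullet> H x \<partial>M) - (\<integral>x. G x \<bullet> H x \<partial>M)) \<longlonglongrightarrow> 0"
    by (intro Lim_null_comparison[OF _ l]) auto
  then show ?thesis by (simp add: LIM_zero_iff)
qed

text \<open>The Poincare inequality acts twice. Together with Cauchy-Schwarz it bounds the square of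
  the integral of u by the energy of u, as the minimisation requires; then it upgrades the Cauchy
  property from gradients to functions, turning the factor 4 into 4 (P + 1).\<close>

lemma minimizing_test_functions:
  assumes M: "\<Omega> \<in> sets lebesgue" "0 < emeasure lebesgue \<Omega>" "emeasure lebesgue \<Omega> < \<infinity>"
  obtains s :: "nat \<Rightarrow> 'a::euclidean_space \<Rightarrow> real" and C where "C \<ge> 0" "\<And>n. test_fun \<Omega> (s n)"
    "\<And>m n. (\<integral>x. (s m x - s n x)\<^sup>2 + (norm (grad (s m) x - grad (s n) x))\<^sup>2 \<partial>lebesgue_on \<Omega>)
       \<le> C * (1 / real (Suc m) + 1 / real (Suc n))"
    "\<And>w. test_fun \<Omega> w \<Longrightarrow>
       (\<lambda>n. \<integral>x. grad (s n) x \<bullet> grad w x \<partial>lebesgue_on \<Omega>) \<longlonglongrightarrow> (\<integral>x. w x \<partial>lebesgue_on \<Omega>)"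
proof -
  let ?M = "lebesgue_on \<Omega>"
  interpret finite_measure ?M by (rule finite_measure_lebesgue_on[OF M(1,3)])
  obtain P where P: "P \<ge> 0" "\<And>f :: 'a \<Rightarrow> real. test_fun \<Omega> f \<Longrightarrow>
    (\<integral>x. (f x)\<^sup>2 \<partial>?M) \<le> P * (\<integral>x. (norm (grad f x))\<^sup>2 \<partial>?M)"
    using Poincare_inequality[OF M] by blast
  define E where "E u = (\<integral>x. (norm (grad u x))\<^sup>2 \<partial>?M)" for u :: "'a \<Rightarrow> real"
  define a where "a u w = (\<integral>x. grad u x \<bullet> grad w x \<partial>?M)" for u w :: "'a \<Rightarrow> real"
  define l where "l u = (\<integral>x. u x \<partial>?M)" for u :: "'a \<Rightarrow> real"
  note int = test_fun_square_integrable[OF _ M(1,3)] and meas = test_fun_measurable_lebesgue_on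
  have inn: "integrable ?M (\<lambda>x. grad u x \<bullet> grad w x)" if "test_fun \<Omega> u" "test_fun \<Omega> w" for u w
    using that by (intro integrable_inner_L2 int meas)
  obtain s where s: "\<And>n. s n \<in> {f. test_fun \<Omega> f}"
    "\<And>m n. E (\<lambda>x. s m x - s n x) \<le> 4 * (1 / real (Suc m) + 1 / real (Suc n))"
    "\<And>w. w \<in> {f. test_fun \<Omega> f} \<Longrightarrow> (\<lambda>n. a (s n) w) \<longlonglongrightarrow> l w"
  proof (rule quadratic_minimizing_sequence[of "{f :: 'a \<Rightarrow> real. test_fun \<Omega> f}" E a l "measure ?M (space ?M) * P"])
    show "{f :: 'a \<Rightarrow> real. test_fun \<Omega> f} \<noteq> {}" using test_fun_zero by blast
    fix u w :: "'a \<Rightarrow> real" and t :: real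
    assume "u \<in> {f. test_fun \<Omega> f}" "w \<in> {f. test_fun \<Omega> f}"
    then have u: "test_fun \<Omega> u" and w: "test_fun \<Omega> w" by auto
    show "(\<lambda>x. u x + t * w x) \<in> {f. test_fun \<Omega> f}"
      using test_fun_add_scale(1)[OF u w] by simp
    have "E (\<lambda>x. u x + t * w x) = (\<integral>x. (norm (grad u x))\<^sup>2 + 2 * t * (grad u x \<bullet> grad w x) + t\<^sup>2 * (norm (grad w x))\<^sup>2 \<partial>?M)"
      unfolding E_def test_fun_add_scale(2)[OF u w]
      by (intro Bochner_Integration.integral_cong)
        (simp_all add: power2_norm_eq_inner, simp add: power2_eq_square algebra_simps inner_commute)
    then show "E (\<lambda>x. u x + t * w x) = E u + 2 * t * a u w + t\<^sup>2 * E w"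
      using int[OF u] int[OF w] inn[OF u w] by (simp add: E_def a_def)
    show "l (\<lambda>x. u x + t * w x) = l u + t * l w"
      using int[OF u] int[OF w] by (simp add: l_def)
  next
    fix u :: "'a \<Rightarrow> real" assume "u \<in> {f. test_fun \<Omega> f}"
    then have u: "test_fun \<Omega> u" by simp
    show "0 \<le> E u" by (simp add: E_def)
    have "(l u)\<^sup>2 \<le> (\<integral>x. \<bar>u x\<bar> \<partial>?M)\<^sup>2"
      unfolding l_def by (subst abs_le_square_iff[symmetric]) (simp add: integral_abs_bound)
    also have "\<dots> \<le> measure ?M (space ?M) * (\<integral>x. (u x)\<^sup>2 \<partial>?M)"
      using u by (intro integral_abs_square_le finite_measure_lebesgue_on M meas int)
    also have "\<dots> \<le> measure ?M (space ?M) * (P * E u)"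
      unfolding E_def by (intro mult_left_mono P u) simp
    finally show "(l u)\<^sup>2 \<le> measure ?M (space ?M) * P * E u" by (simp add: mult_ac)
  qed (use P in auto)
  have t: "test_fun \<Omega> (s n)" for n using s(1) by simp
  have "(\<integral>x. (s m x - s n x)\<^sup>2 + (norm (grad (s m) x - grad (s n) x))\<^sup>2 \<partial>?M)
       \<le> (4 * (P + 1)) * (1 / real (Suc m) + 1 / real (Suc n))" for m n
  proof -
    define d where "d = (\<lambda>x. s m x + (- 1) * s n x)"
    have d: "test_fun \<Omega> d" "grad d = (\<lambda>x. grad (s m) x + (- 1) *\<^sub>R grad (s n) x)"
      unfolding d_def using t test_fun_add_scale by blast+
    have "(\<integral>x. (s m x - s n x)\<^sup>2 + (norm (grad (s m) x - grad (s n) x))\<^sup>2 \<partial>?M)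
      = (\<integral>x. (d x)\<^sup>2 \<partial>?M) + E d"
    proof -
      have "s m x - s n x = d x" "grad (s m) x - grad (s n) x = grad d x" for x
        unfolding d(2) by (simp_all add: d_def)
      then show ?thesis using int[OF d(1)] by (simp add: E_def)
    qed
    also have "\<dots> \<le> (P + 1) * E d"
      using P(2)[OF d(1)] by (simp add: E_def algebra_simps)
    also have "\<dots> \<le> (P + 1) * (4 * (1 / real (Suc m) + 1 / real (Suc n)))"
      using s(2)[of m n] P(1) by (intro mult_left_mono) (auto simp: d_def)
    finally show ?thesis by (simp only: mult.assoc mult.left_commute)
  qed
  then show ?thesis
    using that[of "4 * (P + 1)" s] P(1) t s(3) by (simp add: a_def l_def)
qed

lemma weak_solution_exists:
  fixes \<Omega> :: "'a::euclidean_space set"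
  assumes M: "\<Omega> \<in> sets lebesgue" "0 < emeasure lebesgue \<Omega>" "emeasure lebesgue \<Omega> < \<infinity>"
  shows "\<exists>v G. H01 \<Omega> v G \<and> (\<forall>\<phi>. test_fun \<Omega> \<phi> \<longrightarrow>
     (\<integral>x. G x \<bullet> grad \<phi> x \<partial>lebesgue_on \<Omega>) = (\<integral>x. \<phi> x \<partial>lebesgue_on \<Omega>))"
proof -
  let ?M = "lebesgue_on \<Omega>"
  obtain s :: "nat \<Rightarrow> 'a \<Rightarrow> real" and C where C: "C \<ge> 0" and t: "\<And>n. test_fun \<Omega> (s n)"
    and cau: "\<And>m n. (\<integral>x. (s m x - s n x)\<^sup>2 + (norm (grad (s m) x - grad (s n) x))\<^sup>2 \<partial>?M)
       \<le> C * (1 / real (Suc m) + 1 / real (Suc n))"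
    and lim: "\<And>w. test_fun \<Omega> w \<Longrightarrow>
       (\<lambda>n. \<integral>x. grad (s n) x \<bullet> grad w x \<partial>?M) \<longlonglongrightarrow> (\<integral>x. w x \<partial>?M)"
    by (rule minimizing_test_functions[OF M]) (rule that)
  note int = test_fun_square_integrable[OF _ M(1,3)] and meas = test_fun_measurable_lebesgue_on
  note [measurable] = meas[OF t]
  \<comment> \<open>The squared norm of a pair is the sum of the squared norms, so a single
    completeness argument yields the function and its gradient together.\<close>
  define f where "f n x = (s n x, grad (s n) x)" for n x
  have fm: "f n \<in> borel_measurable ?M" for n
    unfolding f_def by (rule borel_measurable_Pair) simp_all
  have nf: "(norm ((a, b) - f n x))\<^sup>2 = (a - s n x)\<^sup>2 + (norm (b - grad (s n) x))\<^sup>2" for n x a b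
    by (simp add: f_def norm_Pair)
  have cauchy: "\<exists>N. \<forall>m\<ge>N. \<forall>n\<ge>N. (\<integral>\<^sup>+x. ennreal ((norm (f m x - f n x))\<^sup>2) \<partial>?M) \<le> ennreal e" if e: "e > 0" for e
  proof -
    \<comment> \<open>C may be 0, so C + 1 takes its place in the denominator.\<close>
    obtain N where N: "1 / real (Suc N) < e / (2 * (C + 1))"
      using nat_approx_posE[of "e / (2 * (C + 1))"] e C by auto
    show ?thesis
    proof (intro exI allI impI)
      fix m n assume "N \<le> m" "N \<le> n"
      then have mn: "1 / real (Suc m) \<le> 1 / real (Suc N)" "1 / real (Suc n) \<le> 1 / real (Suc N)"
        by (auto intro!: divide_left_mono)
      have "integrable ?M (\<lambda>x. (norm (s m x - s n x))\<^sup>2)"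
        by (rule integrable_norm_diff_L2) (use int[OF t] in simp_all)
      moreover have "integrable ?M (\<lambda>x. (norm (grad (s m) x - grad (s n) x))\<^sup>2)"
        by (rule integrable_norm_diff_L2) (use int[OF t] in simp_all)
      ultimately have "(\<integral>\<^sup>+x. ennreal ((norm (f m x - f n x))\<^sup>2) \<partial>?M)
         = ennreal (\<integral>x. (s m x - s n x)\<^sup>2 + (norm (grad (s m) x - grad (s n) x))\<^sup>2 \<partial>?M)"
        by (subst nn_integral_eq_integral[symmetric]) (auto simp: f_def[of m] nf)
      also have "\<dots> \<le> ennreal ((C + 1) * (1 / real (Suc N) + 1 / real (Suc N)))"
        using C mn by (intro ennreal_leI order_trans[OF cau] mult_mono add_mono) auto
      also have "\<dots> \<le> ennreal e"
        using N C by (intro ennreal_leI) (simp add: field_simps)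
      finally show "(\<integral>\<^sup>+x. ennreal ((norm (f m x - f n x))\<^sup>2) \<partial>?M) \<le> ennreal e" .
    qed
  qed
  obtain g where g[measurable]: "g \<in> borel_measurable ?M"
    and gl: "(\<lambda>n. \<integral>\<^sup>+x. ennreal ((norm (g x - f n x))\<^sup>2) \<partial>?M) \<longlonglongrightarrow> 0"
    using L2_complete[OF fm cauchy] by blast
  \<comment> \<open>The limit is measurable only on \<Omega>; extension by 0 gives functions
    measurable on the whole space, as \<open>H01\<close> demands.\<close>
  define v where "v x = (if x \<in> \<Omega> then fst (g x) else 0)" for x
  define G where "G x = (if x \<in> \<Omega> then snd (g x) else 0)" for x
  have [measurable]: "(\<lambda>x. fst (g x)) \<in> borel_measurable ?M" "(\<lambda>x. snd (g x)) \<in> borel_measurable ?M"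
    by (intro measurable_compose[OF g borel_measurable_continuous_onI] continuous_intros)+
  have vm: "v \<in> borel_measurable lebesgue" and Gm: "G \<in> borel_measurable lebesgue"
    unfolding v_def G_def by (intro borel_measurable_if_I M; simp)+
  have l1: "(\<lambda>n. \<integral>\<^sup>+x\<in>\<Omega>. ennreal ((v x - s n x)\<^sup>2) \<partial>lebesgue) \<longlonglongrightarrow> 0"
  proof (rule tendsto_sandwich[OF _ _ tendsto_const gl])
    show "\<forall>\<^sub>F n in sequentially. (\<integral>\<^sup>+x\<in>\<Omega>. ennreal ((v x - s n x)\<^sup>2) \<partial>lebesgue) \<le> (\<integral>\<^sup>+x. ennreal ((norm (g x - f n x))\<^sup>2) \<partial>?M)"
    proof (intro always_eventually allI)
      fix n
      have "(\<integral>\<^sup>+x\<in>\<Omega>. ennreal ((v x - s n x)\<^sup>2) \<partial>lebesgue) \<le> (\<integral>\<^sup>+x. ennreal ((norm (g x - f n x))\<^sup>2) * indicator \<Omega> x \<partial>lebesgue)"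
        using nf[of "fst (g x)" "snd (g x)" n x for x]
        by (intro nn_integral_mono) (auto simp: v_def split: split_indicator intro!: ennreal_leI)
      then show "(\<integral>\<^sup>+x\<in>\<Omega>. ennreal ((v x - s n x)\<^sup>2) \<partial>lebesgue) \<le> (\<integral>\<^sup>+x. ennreal ((norm (g x - f n x))\<^sup>2) \<partial>?M)"
        using M by (simp add: nn_integral_restrict_space)
    qed
  qed simp
  have l2: "(\<lambda>n. \<integral>\<^sup>+x\<in>\<Omega>. ennreal ((norm (G x - grad (s n) x))\<^sup>2) \<partial>lebesgue) \<longlonglongrightarrow> 0"
  proof (rule tendsto_sandwich[OF _ _ tendsto_const gl])
    show "\<forall>\<^sub>F n in sequentially. (\<integral>\<^sup>+x\<in>\<Omega>. ennreal ((norm (G x - grad (s n) x))\<^sup>2) \<partial>lebesgue) \<le> (\<integral>\<^sup>+x. ennreal ((norm (g x - f n x))\<^sup>2) \<partial>?M)"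
    proof (intro always_eventually allI)
      fix n
      have "(\<integral>\<^sup>+x\<in>\<Omega>. ennreal ((norm (G x - grad (s n) x))\<^sup>2) \<partial>lebesgue) \<le> (\<integral>\<^sup>+x. ennreal ((norm (g x - f n x))\<^sup>2) * indicator \<Omega> x \<partial>lebesgue)"
        using nf[of "fst (g x)" "snd (g x)" n x for x]
        by (intro nn_integral_mono) (auto simp: G_def split: split_indicator intro!: ennreal_leI)
      then show "(\<integral>\<^sup>+x\<in>\<Omega>. ennreal ((norm (G x - grad (s n) x))\<^sup>2) \<partial>lebesgue) \<le> (\<integral>\<^sup>+x. ennreal ((norm (g x - f n x))\<^sup>2) \<partial>?M)"
        using M by (simp add: nn_integral_restrict_space)
    qed
  qed simp
  have H: "H01 \<Omega> v G"
    unfolding H01_def using vm Gm t l1 l2 by blast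
  obtain Gi: "integrable ?M (\<lambda>x. (norm (G x))\<^sup>2)" and [measurable]: "G \<in> borel_measurable ?M"
    using H01_approx[OF H M(1,3)] by metis
  have di: "integrable ?M (\<lambda>x. (norm (G x - grad (s n) x))\<^sup>2)" for n
    by (rule integrable_norm_diff_L2) (use int[OF t] Gi in auto)
  have "(\<integral>\<^sup>+x\<in>\<Omega>. ennreal ((norm (G x - grad (s n) x))\<^sup>2) \<partial>lebesgue) = ennreal (\<integral>x. (norm (G x - grad (s n) x))\<^sup>2 \<partial>?M)" for n
    using di[of n] M by (subst nn_integral_eq_integral[symmetric]) (auto simp: nn_integral_restrict_space)
  then have "(\<lambda>n. ennreal (\<integral>x. (norm (G x - grad (s n) x))\<^sup>2 \<partial>?M)) \<longlonglongrightarrow> ennreal 0"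
    using l2 by simp
  then have Gl: "(\<lambda>n. \<integral>x. (norm (G x - grad (s n) x))\<^sup>2 \<partial>?M) \<longlonglongrightarrow> 0"
    by (subst (asm) tendsto_ennreal_iff) auto
  have "(\<integral>x. G x \<bullet> grad \<phi> x \<partial>?M) = (\<integral>x. \<phi> x \<partial>?M)" if \<phi>: "test_fun \<Omega> \<phi>" for \<phi>
  proof (rule LIMSEQ_unique)
    show "(\<lambda>n. \<integral>x. grad (s n) x \<bullet> grad \<phi> x \<partial>?M) \<longlonglongrightarrow> (\<integral>x. G x \<bullet> grad \<phi> x \<partial>?M)"
      using int[OF t] int[OF \<phi>] meas[OF t] meas[OF \<phi>] Gi Gl by (intro inner_L2_tendsto) auto
  qed (rule lim[OF \<phi>])
  then show ?thesis using H by blast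
qed

section \<open>Boundedness of weak solutions\<close>

text \<open>Testing the equation with a smoothed truncation \<open>w = (v - k)\<^sup>+\<close> bounds the energy of \<open>w\<close> by its
  integral, because the derivative \<open>s\<close> of the truncation satisfies \<open>s\<^sup>2 \<le> s\<close>.\<close>
lemma level_set_energy_estimate:
  fixes v :: "'a::euclidean_space \<Rightarrow> real"
  assumes H: "H01 \<Omega> v G" and M: "\<Omega> \<in> sets lebesgue" "emeasure lebesgue \<Omega> < \<infinity>"
    and weak: "\<And>\<phi>. test_fun \<Omega> \<phi> \<Longrightarrow>
      (\<integral>x. G x \<bullet> grad \<phi> x \<partial>lebesgue_on \<Omega>) = c * (\<integral>x. \<phi> x \<partial>lebesgue_on \<Omega>)"
    and c: "\<bar>c\<bar> \<le> 1" and k: "k \<ge> 0" and R: "R \<ge> 0"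
  defines "V \<equiv> measure lborel (ball (0::'a) R)" and "w \<equiv> \<lambda>x. max 0 (v x - k)"
  shows "2 * V * (\<integral>x. (w x)\<^sup>2 \<partial>lebesgue_on \<Omega>)
      \<le> V * R\<^sup>2 * (\<integral>x. w x \<partial>lebesgue_on \<Omega>) + 2 * (\<integral>x. w x \<partial>lebesgue_on \<Omega>)\<^sup>2" (is ?est)
    and "integrable (lebesgue_on \<Omega>) (\<lambda>x. (w x)\<^sup>2)" (is ?int)
proof -
  let ?M = "lebesgue_on \<Omega>"
  interpret finite_measure ?M by (rule finite_measure_lebesgue_on[OF M])
  obtain \<phi> where t: "\<And>j. test_fun \<Omega> (\<phi> j)"
    and vi: "\<And>j. integrable ?M (\<lambda>x. (v x - \<phi> j x)\<^sup>2)" and vl: "(\<lambda>j. \<integral>x. (v x - \<phi> j x)\<^sup>2 \<partial>?M) \<longlonglongrightarrow> 0"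
    and Gi: "\<And>j. integrable ?M (\<lambda>x. (norm (G x - grad (\<phi> j) x))\<^sup>2)"
    and Gl: "(\<lambda>j. \<integral>x. (norm (G x - grad (\<phi> j) x))\<^sup>2 \<partial>?M) \<longlonglongrightarrow> 0"
    and [measurable]: "v \<in> borel_measurable ?M" "G \<in> borel_measurable ?M"
    and v2: "integrable ?M (\<lambda>x. (v x)\<^sup>2)" and G2: "integrable ?M (\<lambda>x. (norm (G x))\<^sup>2)"
    by (rule H01_approx[OF H M]) (rule that)
  note int = test_fun_square_integrable[OF _ M] and meas = test_fun_measurable_lebesgue_on
  define e where "e j = 1 / real (Suc j)" for j
  have e: "e j > 0" for j by (simp add: e_def)
  have el: "e \<longlonglongrightarrow> 0" unfolding e_def using LIMSEQ_Suc[OF lim_1_over_n] .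
  \<comment> \<open>Truncating the approximants instead of v keeps f j admissible in the weak
    equation. Its L2 distance to w is controlled by that of \<phi> j to v and by e j, both tending
    to 0.\<close>
  define f where "f j x = soft_plus k (e j) (\<phi> j x)" for j x
  have ft: "test_fun \<Omega> (f j)" for j
    unfolding f_def using test_fun_soft_plus(1)[OF t e] .
  note [measurable] = meas[OF t] meas[OF ft]
  have wm[measurable]: "w \<in> borel_measurable ?M" unfolding w_def by measurable
  have w2: "integrable ?M (\<lambda>x. (w x)\<^sup>2)"
  proof (rule Bochner_Integration.integrable_bound[OF v2])
    show "AE x in ?M. norm ((w x)\<^sup>2) \<le> norm ((v x)\<^sup>2)"
      using k by (auto simp: w_def max_def intro!: AE_I2 power_mono)
  qed simp
  show ?int by fact
  have fw: "(f j x - w x)\<^sup>2 \<le> 2 * (v x - \<phi> j x)\<^sup>2 + 2 * (e j)\<^sup>2" for j x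
  proof -
    have "\<bar>f j x - max 0 (\<phi> j x - k)\<bar> \<le> e j"
      unfolding f_def by (rule soft_plus_approx[OF k e])
    moreover have "\<bar>max 0 (\<phi> j x - k) - w x\<bar> \<le> \<bar>v x - \<phi> j x\<bar>"
      unfolding w_def by linarith
    ultimately have "\<bar>f j x - w x\<bar> \<le> \<bar>v x - \<phi> j x\<bar> + e j" by linarith
    then have "(f j x - w x)\<^sup>2 \<le> (\<bar>v x - \<phi> j x\<bar> + e j)\<^sup>2"
      by (metis abs_ge_zero power2_abs power_mono)
    also have "\<dots> \<le> 2 * \<bar>v x - \<phi> j x\<bar>\<^sup>2 + 2 * (e j)\<^sup>2"
      using zero_le_power2[of "\<bar>v x - \<phi> j x\<bar> - e j"] by (simp only: power2_sum power2_diff)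
    finally show ?thesis by simp
  qed
  have fwi: "integrable ?M (\<lambda>x. (f j x - w x)\<^sup>2)" for j
  proof (rule Bochner_Integration.integrable_bound)
    show "integrable ?M (\<lambda>x. 2 * (v x - \<phi> j x)\<^sup>2 + 2 * (e j)\<^sup>2)" using vi by simp
    show "AE x in ?M. norm ((f j x - w x)\<^sup>2) \<le> norm (2 * (v x - \<phi> j x)\<^sup>2 + 2 * (e j)\<^sup>2)"
      using fw by (intro AE_I2) auto
  qed simp
  have fwl: "(\<lambda>j. \<integral>x. (f j x - w x)\<^sup>2 \<partial>?M) \<longlonglongrightarrow> 0"
  proof (rule tendsto_sandwich[where f = "\<lambda>_. 0"])
    have "(\<integral>x. (f j x - w x)\<^sup>2 \<partial>?M) \<le> 2 * (\<integral>x. (v x - \<phi> j x)\<^sup>2 \<partial>?M) + 2 * (e j)\<^sup>2 * measure ?M (space ?M)" for j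
    proof -
      have "(\<integral>x. (f j x - w x)\<^sup>2 \<partial>?M) \<le> (\<integral>x. 2 * (v x - \<phi> j x)\<^sup>2 + 2 * (e j)\<^sup>2 \<partial>?M)"
        using fw fwi vi by (intro integral_mono) auto
      also have "\<dots> = 2 * (\<integral>x. (v x - \<phi> j x)\<^sup>2 \<partial>?M) + 2 * (e j)\<^sup>2 * measure ?M (space ?M)"
        using vi[of j] by simp
      finally show ?thesis .
    qed
    then show "\<forall>\<^sub>F j in sequentially. (\<integral>x. (f j x - w x)\<^sup>2 \<partial>?M)
        \<le> 2 * (\<integral>x. (v x - \<phi> j x)\<^sup>2 \<partial>?M) + 2 * (e j)\<^sup>2 * measure ?M (space ?M)"
      by (intro always_eventually allI)
    have "(\<lambda>j. 2 * (\<integral>x. (v x - \<phi> j x)\<^sup>2 \<partial>?M) + 2 * (e j)\<^sup>2 * measure ?M (space ?M))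
        \<longlonglongrightarrow> 2 * 0 + 2 * 0\<^sup>2 * measure ?M (space ?M)"
      by (intro tendsto_intros vl el)
    then show "(\<lambda>j. 2 * (\<integral>x. (v x - \<phi> j x)\<^sup>2 \<partial>?M) + 2 * (e j)\<^sup>2 * measure ?M (space ?M)) \<longlonglongrightarrow> 0"
      by simp
    show "\<forall>\<^sub>F j in sequentially. (0::real) \<le> (\<integral>x. (f j x - w x)\<^sup>2 \<partial>?M)" by simp
  qed simp
  note lims = L2_convergence[OF finite_measure_axioms meas(1)[OF ft] wm fwi w2 fwl]
  define d where "d j x = norm (G x - grad (\<phi> j) x)" for j x
  have dm[measurable]: "d j \<in> borel_measurable ?M" for j unfolding d_def by measurable
  have dG: "integrable ?M (\<lambda>x. \<bar>d j x * norm (G x)\<bar>)" for j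
    by (intro integrable_abs integrable_mult_L2) (use Gi G2 in \<open>auto simp: d_def\<close>)
  \<comment> \<open>The cost of replacing the gradient of \<phi> j by G in one factor of the energy,
    which is what makes the weak equation applicable to f j.\<close>
  define r where "r j = (\<integral>x. (d j x)\<^sup>2 \<partial>?M) + (\<integral>x. \<bar>d j x * norm (G x)\<bar> \<partial>?M)" for j
  have "(\<lambda>j. \<integral>x. \<bar>d j x * norm (G x)\<bar> \<partial>?M) \<longlonglongrightarrow> 0"
    by (rule L2_null_mult) (use Gi Gl G2 in \<open>auto simp: d_def\<close>)
  then have rl: "r \<longlonglongrightarrow> 0"
    unfolding r_def using tendsto_add[OF Gl] by (fastforce simp: d_def)
  have energy: "(\<integral>x. (norm (grad (f j) x))\<^sup>2 \<partial>?M) \<le> r j + (\<integral>x. \<bar>f j x\<bar> \<partial>?M)" for j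
  proof -
    have Gf: "integrable ?M (\<lambda>x. G x \<bullet> grad (f j) x)"
      by (intro integrable_inner_L2) (use G2 int[OF ft] in auto)
    have d2: "integrable ?M (\<lambda>x. (d j x)\<^sup>2)" using Gi by (simp add: d_def)
    have "(\<integral>x. (norm (grad (f j) x))\<^sup>2 \<partial>?M) \<le> (\<integral>x. ((d j x)\<^sup>2 + \<bar>d j x * norm (G x)\<bar>) + G x \<bullet> grad (f j) x \<partial>?M)"
    proof (rule integral_mono)
      fix x
      let ?D = "grad (\<phi> j) x"
      obtain s where s: "0 \<le> s" "s \<le> 1" "grad (f j) x = s *\<^sub>R ?D"
        unfolding f_def using test_fun_soft_plus(2)[OF t e] by blast
      have "(norm (grad (f j) x))\<^sup>2 = s * (s * (norm ?D)\<^sup>2)"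
        using s by (simp add: power_mult_distrib power2_eq_square)
      also have "\<dots> \<le> 1 * (s * (norm ?D)\<^sup>2)"
        using s by (intro mult_right_mono) auto
      also have "\<dots> = s * ((?D - G x) \<bullet> ?D) + G x \<bullet> grad (f j) x"
        by (simp add: s(3) power2_norm_eq_inner inner_diff_left algebra_simps)
      also have "s * ((?D - G x) \<bullet> ?D) \<le> s * (d j x * norm ?D)"
        unfolding d_def using norm_cauchy_schwarz[of "?D - G x" ?D] s
        by (intro mult_left_mono) (auto simp: norm_minus_commute)
      also have "\<dots> \<le> 1 * (d j x * norm ?D)"
        using s by (intro mult_right_mono) (auto simp: d_def)
      also have "\<dots> \<le> 1 * (d j x * (d j x + norm (G x)))"
        unfolding d_def using norm_triangle_sub[of ?D "G x"]
        by (intro mult_left_mono) (auto simp: norm_minus_commute)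
      also have "\<dots> = (d j x)\<^sup>2 + \<bar>d j x * norm (G x)\<bar>"
        by (simp add: d_def power2_eq_square algebra_simps)
      finally show "(norm (grad (f j) x))\<^sup>2 \<le> ((d j x)\<^sup>2 + \<bar>d j x * norm (G x)\<bar>) + G x \<bullet> grad (f j) x"
        by simp
    qed (use int[OF ft] Gf d2 dG in auto)
    also have "\<dots> = r j + c * (\<integral>x. f j x \<partial>?M)"
      using Gf d2 dG[of j] weak[OF ft[of j]] by (simp add: r_def)
    also have "c * (\<integral>x. f j x \<partial>?M) \<le> \<bar>c\<bar> * (\<integral>x. \<bar>f j x\<bar> \<partial>?M)"
      by (rule order_trans[OF abs_ge_self]) (simp only: abs_mult mult_left_mono[OF integral_abs_bound] abs_ge_zero)
    also have "\<dots> \<le> 1 * (\<integral>x. \<bar>f j x\<bar> \<partial>?M)"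
      using c by (intro mult_right_mono) auto
    finally show ?thesis by simp
  qed
  have V0: "V \<ge> 0" by (simp add: V_def)
  have ineq: "2 * V * (\<integral>x. (f j x)\<^sup>2 \<partial>?M)
      \<le> V * R\<^sup>2 * (r j + (\<integral>x. \<bar>f j x\<bar> \<partial>?M)) + 2 * (\<integral>x. \<bar>f j x\<bar> \<partial>?M)\<^sup>2" for j
  proof -
    have "V * R\<^sup>2 * (\<integral>x. (norm (grad (f j) x))\<^sup>2 \<partial>?M) \<le> V * R\<^sup>2 * (r j + (\<integral>x. \<bar>f j x\<bar> \<partial>?M))"
      using energy V0 by (intro mult_left_mono) auto
    then show ?thesis using Nash_inequality[OF ft[of j] M R] unfolding V_def by linarith
  qed
  \<comment> \<open>The gradient of f j has been eliminated through \<open>energy\<close>, so L2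
    convergence of f j to w suffices for the limit.\<close>
  have "2 * V * (\<integral>x. (w x)\<^sup>2 \<partial>?M) \<le> V * R\<^sup>2 * (0 + (\<integral>x. \<bar>w x\<bar> \<partial>?M)) + 2 * (\<integral>x. \<bar>w x\<bar> \<partial>?M)\<^sup>2"
  proof (rule LIMSEQ_le)
    show "(\<lambda>j. 2 * V * (\<integral>x. (f j x)\<^sup>2 \<partial>?M)) \<longlonglongrightarrow> 2 * V * (\<integral>x. (w x)\<^sup>2 \<partial>?M)"
      by (intro tendsto_intros lims)
    show "(\<lambda>j. V * R\<^sup>2 * (r j + (\<integral>x. \<bar>f j x\<bar> \<partial>?M)) + 2 * (\<integral>x. \<bar>f j x\<bar> \<partial>?M)\<^sup>2)
      \<longlonglongrightarrow> V * R\<^sup>2 * (0 + (\<integral>x. \<bar>w x\<bar> \<partial>?M)) + 2 * (\<integral>x. \<bar>w x\<bar> \<partial>?M)\<^sup>2"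
      by (intro tendsto_intros lims rl)
  qed (use ineq in blast)
  moreover have "\<bar>w x\<bar> = w x" for x by (simp add: w_def)
  ultimately show ?est by simp
qed

text \<open>Choose the radius in the energy estimate so that the ball has volume \<open>2 b\<close>; the term
  \<open>2 (\<integral> w)\<^sup>2\<close> is then absorbed by the left-hand side.\<close>
lemma level_set_halving:
  fixes v :: "'a::euclidean_space \<Rightarrow> real"
  assumes H: "H01 \<Omega> v G" and M: "\<Omega> \<in> sets lebesgue" "emeasure lebesgue \<Omega> < \<infinity>"
    and weak: "\<And>\<phi>. test_fun \<Omega> \<phi> \<Longrightarrow>
      (\<integral>x. G x \<bullet> grad \<phi> x \<partial>lebesgue_on \<Omega>) = c * (\<integral>x. \<phi> x \<partial>lebesgue_on \<Omega>)"
    and c: "\<bar>c\<bar> \<le> 1"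
  obtains C where "C > 0" "\<And>k b. k \<ge> 0 \<Longrightarrow> b > 0 \<Longrightarrow>
    measure (lebesgue_on \<Omega>) {x\<in>space (lebesgue_on \<Omega>). v x > k} \<le> b \<Longrightarrow>
    measure (lebesgue_on \<Omega>) {x\<in>space (lebesgue_on \<Omega>). v x > k + C * b powr (2 / DIM('a))} \<le> b / 2"
proof -
  let ?M = "lebesgue_on \<Omega>"
  interpret finite_measure ?M by (rule finite_measure_lebesgue_on[OF M])
  have vm[measurable]: "v \<in> borel_measurable ?M"
    using H by (auto simp: H01_def intro: measurable_restrict_space1)
  obtain q where q: "q > 0" "\<And>b. b > 0 \<Longrightarrow> measure lborel (ball (0::'a) (q * b powr (1 / DIM('a)))) = b"
    using ball_radius_of_volume[where 'a = 'a] by blast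
  \<comment> \<open>Chosen so that C b^(2/m) = 2 R^2 for the radius R of the ball of volume
    2b.\<close>
  define C where "C = 2 * q\<^sup>2 * 2 powr (2 / DIM('a))"
  have C: "C > 0" using q by (simp add: C_def)
  have "measure ?M {x\<in>space ?M. v x > k + C * b powr (2 / DIM('a))} \<le> b / 2"
    if k: "k \<ge> 0" and b: "b > 0" and A: "measure ?M {x\<in>space ?M. v x > k} \<le> b" for k b
  proof -
    define R where "R = q * (2 * b) powr (1 / DIM('a))"
    have R: "R > 0" "measure lborel (ball (0::'a) R) = 2 * b"
      using q b by (auto simp: R_def)
    have R2: "C * b powr (2 / DIM('a)) = 2 * R\<^sup>2"
    proof -
      have "R\<^sup>2 = q\<^sup>2 * (2 * b) powr (2 / DIM('a))"
        using b by (simp add: R_def power_mult_distrib powr_power)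
      then show ?thesis using b by (simp add: C_def powr_mult)
    qed
    define w where "w x = max 0 (v x - k)" for x
    have wm[measurable]: "w \<in> borel_measurable ?M" unfolding w_def by measurable
    define X Y where "X = (\<integral>x. (w x)\<^sup>2 \<partial>?M)" and "Y = (\<integral>x. w x \<partial>?M)"
    have w2: "integrable ?M (\<lambda>x. (w x)\<^sup>2)"
      unfolding w_def by (rule level_set_energy_estimate(2)[OF H M weak c k]) (use R in auto)
    have wi: "integrable ?M w"
      using integrable_mult_L2[of w ?M "\<lambda>_. 1"] w2 by simp
    have est: "2 * (2 * b) * X \<le> (2 * b) * R\<^sup>2 * Y + 2 * Y\<^sup>2"
      unfolding X_def Y_def w_def R(2)[symmetric]
      by (rule level_set_energy_estimate(1)[OF H M weak c k]) (use R in auto)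
    have X0: "X \<ge> 0" and Y0: "Y \<ge> 0" by (auto simp: X_def Y_def w_def)
    define A' where "A' = {x\<in>space ?M. v x > k}"
    have A'[measurable]: "A' \<in> sets ?M" unfolding A'_def by measurable
    have A'_sub: "A' \<inter> \<Omega> = A'" by (auto simp: A'_def space_restrict_space)
    \<comment> \<open>As w lives on \<open>A'\<close>, Cauchy-Schwarz gives Y^2 \<le> b X. In
      \<open>est\<close> the left-hand side is then at least 4 Y^2, which leaves Y \<le> b
      R^2.\<close>
    have "(\<integral>x. \<bar>w x * indicator A' x\<bar> \<partial>?M)\<^sup>2 \<le> (\<integral>x. (w x)\<^sup>2 \<partial>?M) * (\<integral>x. (indicator A' x)\<^sup>2 \<partial>?M)"
      using w2 by (intro Cauchy_Schwarz_integral) (auto simp: power2_eq_square indicator_inter_arith[symmetric] emeasure_eq_measure intro!: integrable_real_indicator)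
    moreover have "(\<integral>x. \<bar>w x * indicator A' x\<bar> \<partial>?M) = Y"
      unfolding Y_def by (intro Bochner_Integration.integral_cong) (auto simp: w_def A'_def split: split_indicator)
    moreover have "(\<integral>x. (indicator A' x)\<^sup>2 \<partial>?M) = measure ?M A'"
      by (simp add: power2_eq_square indicator_inter_arith[symmetric] A'_sub)
    ultimately have "Y\<^sup>2 \<le> X * measure ?M A'" by (simp add: X_def)
    also have "\<dots> \<le> X * b" using X0 A unfolding A'_def by (intro mult_left_mono)
    finally have "Y * Y \<le> (b * R\<^sup>2) * Y"
      using est by (simp add: power2_eq_square mult_ac)
    then have Y: "Y \<le> b * R\<^sup>2"
      using Y0 R b by (cases "Y = 0") auto
    define B where "B = {x\<in>space ?M. v x > k + 2 * R\<^sup>2}"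
    have B[measurable]: "B \<in> sets ?M" unfolding B_def by measurable
    have B_sub: "B \<inter> \<Omega> = B" by (auto simp: B_def space_restrict_space)
    \<comment> \<open>Chebyshev: w exceeds 2 R^2 on B while its integral is at most b R^2, so B has
      measure at most b/2.\<close>
    have "2 * R\<^sup>2 * measure ?M B = (\<integral>x. 2 * R\<^sup>2 * indicator B x \<partial>?M)" by (simp add: B_sub)
    also have "\<dots> \<le> Y"
      unfolding Y_def
    proof (rule integral_mono[OF _ wi])
      show "2 * R\<^sup>2 * indicator B x \<le> w x" for x
        by (auto simp: w_def B_def split: split_indicator)
    qed (auto intro!: integrable_real_indicator simp: emeasure_eq_measure)
    finally have "R\<^sup>2 * (2 * measure ?M B) \<le> R\<^sup>2 * b" using Y by (simp add: mult_ac)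
    then have "2 * measure ?M B \<le> b" using R(1) by simp
    then show ?thesis unfolding R2 B_def by simp
  qed
  then show ?thesis using that C by blast
qed

lemma weak_solution_bounded_above:
  fixes v :: "'a::euclidean_space \<Rightarrow> real"
  assumes H: "H01 \<Omega> v G" and M: "\<Omega> \<in> sets lebesgue" "emeasure lebesgue \<Omega> < \<infinity>"
    and weak: "\<And>\<phi>. test_fun \<Omega> \<phi> \<Longrightarrow>
      (\<integral>x. G x \<bullet> grad \<phi> x \<partial>lebesgue_on \<Omega>) = c * (\<integral>x. \<phi> x \<partial>lebesgue_on \<Omega>)"
    and c: "\<bar>c\<bar> \<le> 1"
  shows "\<exists>K. AE x in lebesgue_on \<Omega>. v x \<le> K"
proof -
  let ?M = "lebesgue_on \<Omega>" and ?p = "2 / real DIM('a)"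
  interpret finite_measure ?M by (rule finite_measure_lebesgue_on[OF M])
  have vm[measurable]: "v \<in> borel_measurable ?M"
    using H by (auto simp: H01_def intro: measurable_restrict_space1)
  obtain C where C: "C > 0" "\<And>k b. k \<ge> 0 \<Longrightarrow> b > 0 \<Longrightarrow>
    measure ?M {x\<in>space ?M. v x > k} \<le> b \<Longrightarrow>
    measure ?M {x\<in>space ?M. v x > k + C * b powr ?p} \<le> b / 2"
    by (rule level_set_halving[OF H M weak c]) (use that in blast)+
  \<comment> \<open>The summand 1 keeps the bounds positive, since \<Omega> may here have measure
    0.\<close>
  define b where "b n = (measure ?M (space ?M) + 1) * (1 / 2) ^ n" for n
  have b: "b n > 0" "b (Suc n) = b n / 2" for n
    by (auto simp: b_def add_nonneg_pos)
  define k where "k n = (\<Sum>i<n. C * b i powr ?p)" for n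
  have k0: "k n \<ge> 0" for n using C(1) by (auto simp: k_def intro!: sum_nonneg)
  have meas_k: "measure ?M {x\<in>space ?M. v x > k n} \<le> b n" for n
  proof (induction n)
    case 0
    have "measure ?M {x\<in>space ?M. v x > k 0} \<le> measure ?M (space ?M)"
      by (rule finite_measure_mono) auto
    then show ?case by (simp add: b_def)
  next
    case (Suc n)
    then show ?case using C(2)[OF k0 b(1), of n n] b(2)[of n] by (simp add: k_def)
  qed
  \<comment> \<open>Halving b multiplies the level increment C b^(2/m) by this ratio.\<close>
  define \<rho> where "\<rho> = (1 / 2) powr ?p"
  have \<rho>: "0 < \<rho>" "\<rho> < 1" using powr_less_mono2[of ?p "1 / 2" 1] by (auto simp: \<rho>_def)
  have b_powr: "b i powr ?p = (measure ?M (space ?M) + 1) powr ?p * \<rho> ^ i" for i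
    by (simp add: b_def powr_mult \<rho>_def powr_power powr_realpow[symmetric] powr_powr mult.commute)
  have sm: "summable (\<lambda>i. C * b i powr ?p)"
    unfolding b_powr using \<rho> by (intro summable_mult summable_geometric) auto
  \<comment> \<open>The limit of the levels: {v > K} is contained in every {v > k n}, whose measure
    is at most b n.\<close>
  define K where "K = (\<Sum>i. C * b i powr ?p)"
  have kK: "k n \<le> K" for n
    unfolding k_def K_def using C(1) by (intro sum_le_suminf sm) auto
  have le: "measure ?M {x\<in>space ?M. v x > K} \<le> b n" for n
  proof (rule order_trans[OF finite_measure_mono meas_k[of n]])
    show "{x\<in>space ?M. v x > k n} \<in> sets ?M" by measurable
  qed (use kK[of n] in auto)
  have "b \<longlonglongrightarrow> (measure ?M (space ?M) + 1) * 0"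
    unfolding b_def by (intro tendsto_intros LIMSEQ_power_zero) simp
  then have "measure ?M {x\<in>space ?M. v x > K} \<le> 0"
    using le by (intro LIMSEQ_le_const) auto
  then have "emeasure ?M {x\<in>space ?M. v x > K} = 0"
    by (simp add: emeasure_eq_measure measure_le_0_iff)
  moreover have "{x\<in>space ?M. v x > K} \<in> sets ?M" by measurable
  ultimately have "AE x in ?M. \<not> v x > K"
    by (subst AE_iff_measurable[of "{x\<in>space ?M. v x > K}"]) auto
  then show ?thesis by (auto simp: not_less)
qed

text \<open>The function -v solves the equation with right-hand side -1. This is why the preceding
  estimates carry a constant c with \<bar>c\<bar> \<le> 1: they bound v on both sides without any
  knowledge of its sign.\<close>

lemma weak_solution_bounded:
  fixes v :: "'a::euclidean_space \<Rightarrow> real"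
  assumes H: "H01 \<Omega> v G" and M: "\<Omega> \<in> sets lebesgue" "emeasure lebesgue \<Omega> < \<infinity>"
    and weak: "\<And>\<phi>. test_fun \<Omega> \<phi> \<Longrightarrow>
      (\<integral>x. G x \<bullet> grad \<phi> x \<partial>lebesgue_on \<Omega>) = (\<integral>x. \<phi> x \<partial>lebesgue_on \<Omega>)"
  shows "\<exists>K. AE x in lebesgue_on \<Omega>. \<bar>v x\<bar> \<le> K"
proof -
  obtain \<phi> where \<phi>: "\<And>k. test_fun \<Omega> (\<phi> k)"
    "(\<lambda>k. \<integral>\<^sup>+ x\<in>\<Omega>. ennreal ((v x - \<phi> k x)\<^sup>2) \<partial>lebesgue) \<longlonglongrightarrow> 0"
    "(\<lambda>k. \<integral>\<^sup>+ x\<in>\<Omega>. ennreal ((norm (G x - grad (\<phi> k) x))\<^sup>2) \<partial>lebesgue) \<longlonglongrightarrow> 0"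
    using H unfolding H01_def by blast
  have neg: "test_fun \<Omega> (\<lambda>x. - \<phi> k x)" "grad (\<lambda>x. - \<phi> k x) x = - grad (\<phi> k) x" for k x
    using test_fun_add_scale[OF \<phi>(1) \<phi>(1), of k "- 2" k] by (simp_all add: scaleR_2)
  have "H01 \<Omega> (\<lambda>x. - v x) (\<lambda>x. - G x)"
    unfolding H01_def
  proof (intro conjI exI[of _ "\<lambda>k x. - \<phi> k x"])
    have "(- v x - - \<phi> k x)\<^sup>2 = (v x - \<phi> k x)\<^sup>2" for k x by (simp add: power2_commute)
    then show "(\<lambda>k. \<integral>\<^sup>+ x\<in>\<Omega>. ennreal ((- v x - - \<phi> k x)\<^sup>2) \<partial>lebesgue) \<longlonglongrightarrow> 0" using \<phi>(2) by (simp only:)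
    have "norm (- G x - grad (\<lambda>x. - \<phi> k x) x) = norm (G x - grad (\<phi> k) x)" for k x
      unfolding neg by (simp add: norm_minus_commute)
    then show "(\<lambda>k. \<integral>\<^sup>+ x\<in>\<Omega>. ennreal ((norm (- G x - grad (\<lambda>x. - \<phi> k x) x))\<^sup>2) \<partial>lebesgue) \<longlonglongrightarrow> 0"
      using \<phi>(3) by (simp only:)
  qed (use H neg in \<open>auto simp: H01_def\<close>)
  then have "\<exists>K. AE x in lebesgue_on \<Omega>. - v x \<le> K"
    by (rule weak_solution_bounded_above[OF _ M, where c = "- 1"]) (use weak in auto)
  moreover have "\<exists>K. AE x in lebesgue_on \<Omega>. v x \<le> K"
    by (rule weak_solution_bounded_above[OF H M, where c = 1]) (use weak in auto)
  ultimately obtain K1 K2 where "AE x in lebesgue_on \<Omega>. - v x \<le> K1" "AE x in lebesgue_on \<Omega>. v x \<le> K2"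
    by blast
  then have "AE x in lebesgue_on \<Omega>. \<bar>v x\<bar> \<le> max K1 K2"
    by eventually_elim auto
  then show ?thesis by blast
qed

section \<open>Normalised norms as functions of the exponent\<close>

definition mean_norm :: "ereal \<Rightarrow> 'a::euclidean_space set \<Rightarrow> ('a \<Rightarrow> real) \<Rightarrow> real" where
  "mean_norm p \<Omega> v = (if p = \<infinity> then Linf_norm \<Omega> v
     else Lp_norm (real_of_ereal p) \<Omega> v / measure lebesgue \<Omega> powr (1 / real_of_ereal p))"

lemma Ffun_eq_mean_norm: "Ffun p \<Omega> = mean_norm p \<Omega> (torsion \<Omega>) * lambda1 \<Omega>"
  by (simp add: Ffun_def mean_norm_def)

context
  fixes \<Omega> :: "'a::euclidean_space set" and v :: "'a \<Rightarrow> real"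
  assumes M: "\<Omega> \<in> sets lebesgue" "0 < emeasure lebesgue \<Omega>" "emeasure lebesgue \<Omega> < \<infinity>"
    and vm: "v \<in> borel_measurable lebesgue"
begin

private lemma fin: "finite_measure (lebesgue_on \<Omega>)"
  by (rule finite_measure_lebesgue_on[OF M(1,3)])

private lemma measure_space: "measure (lebesgue_on \<Omega>) (space (lebesgue_on \<Omega>)) = measure lebesgue \<Omega>"
  using M(1) by (simp add: measure_restrict_space space_restrict_space)

private lemma measure_pos: "measure lebesgue \<Omega> > 0"
proof -
  have "ennreal (measure lebesgue \<Omega>) = emeasure lebesgue \<Omega>"
    using M(3) emeasure_eq_ennreal_measure[of lebesgue \<Omega>] by (metis infinity_ennreal_def less_irrefl)
  then show ?thesis using M(2) by (metis ennreal_eq_0_iff less_irrefl not_le)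
qed

private lemma v_measurable_on: "v \<in> borel_measurable (lebesgue_on \<Omega>)"
  using vm by (rule measurable_restrict_space1)

private definition mean_power :: "real \<Rightarrow> real" where
  "mean_power p = (\<integral>x. \<bar>v x\<bar> powr p \<partial>lebesgue_on \<Omega>) / measure lebesgue \<Omega>"

private lemma mean_power_nonneg: "mean_power p \<ge> 0"
  by (simp add: mean_power_def)

private lemma mean_norm_real: "mean_norm (ereal p) \<Omega> v = mean_power p powr (1 / p)"
  using measure_pos M(1)
  by (simp add: mean_norm_def Lp_norm_def mean_power_def set_integral_eq_lebesgue_on powr_divide)

private lemma integrable_powr:
  assumes K: "AE x in lebesgue_on \<Omega>. \<bar>v x\<bar> \<le> K" and p: "p > 0"
  shows "integrable (lebesgue_on \<Omega>) (\<lambda>x. \<bar>v x\<bar> powr p)"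
proof -
  interpret finite_measure "lebesgue_on \<Omega>" by (rule fin)
  note [measurable] = v_measurable_on
  show ?thesis
  proof (rule integrable_const_bound)
    show "AE x in lebesgue_on \<Omega>. norm (\<bar>v x\<bar> powr p) \<le> K powr p"
      using K by eventually_elim (use p in \<open>auto intro!: powr_mono2\<close>)
  qed simp
qed

private lemma mean_norm_real_le:
  assumes K: "AE x in lebesgue_on \<Omega>. \<bar>v x\<bar> \<le> K" "K \<ge> 0" and p: "p > 0"
  shows "mean_norm (ereal p) \<Omega> v \<le> K"
proof -
  interpret finite_measure "lebesgue_on \<Omega>" by (rule fin)
  have "(\<integral>x. \<bar>v x\<bar> powr p \<partial>lebesgue_on \<Omega>) \<le> (\<integral>x. K powr p \<partial>lebesgue_on \<Omega>)"
  proof (rule integral_mono_AE)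
    show "AE x in lebesgue_on \<Omega>. \<bar>v x\<bar> powr p \<le> K powr p"
      using K(1) by eventually_elim (use p in \<open>auto intro!: powr_mono2\<close>)
  qed (use integrable_powr[OF K(1) p] in auto)
  also have "\<dots> = K powr p * measure lebesgue \<Omega>"
    using measure_space by simp
  finally have "mean_power p \<le> K powr p"
    using measure_pos by (simp add: mean_power_def field_simps)
  then have "mean_power p powr (1 / p) \<le> (K powr p) powr (1 / p)"
    using p by (intro powr_mono2) (auto simp: mean_power_nonneg)
  also have "\<dots> = K" using p K(2) by (simp add: powr_powr)
  finally show ?thesis by (simp add: mean_norm_real)
qed

text \<open>Jensen's inequality for the concave power \<theta> = q/p, obtained from its tangent-line
  bound at the mean value A. Division by A is why a vanishing mean is treated apart; v is then 0
  almost everywhere.\<close>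

private lemma mean_norm_real_mono:
  assumes K: "AE x in lebesgue_on \<Omega>. \<bar>v x\<bar> \<le> K" and pq: "0 < q" "q \<le> p"
  shows "mean_norm (ereal q) \<Omega> v \<le> mean_norm (ereal p) \<Omega> v"
proof (cases "mean_power p = 0")
  case True
  have "AE x in lebesgue_on \<Omega>. \<bar>v x\<bar> powr p = 0"
    using True measure_pos integrable_powr[OF K, of p] pq
    by (subst (asm) mean_power_def) (auto simp: integral_nonneg_eq_0_iff_AE)
  then have "AE x in lebesgue_on \<Omega>. \<bar>v x\<bar> \<le> 0"
    by eventually_elim auto
  then have "mean_norm (ereal q) \<Omega> v \<le> 0"
    using pq by (intro mean_norm_real_le) auto
  also have "0 \<le> mean_norm (ereal p) \<Omega> v" by (simp add: mean_norm_real)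
  finally show ?thesis .
next
  case False
  interpret finite_measure "lebesgue_on \<Omega>" by (rule fin)
  define A where "A = mean_power p"
  have A: "A > 0" using False mean_power_nonneg[of p] by (simp add: A_def)
  define \<theta> where "\<theta> = q / p"
  have \<theta>: "0 < \<theta>" "\<theta> \<le> 1" using pq by (auto simp: \<theta>_def)
  \<comment> \<open>Young's inequality z^\<theta> \<le> \<theta> z + (1 - \<theta>) at z = \<bar>v
    x\<bar>^p / A, whose mean is 1; integration therefore yields exactly A^\<theta>.\<close>
  have "\<bar>v x\<bar> powr q \<le> A powr \<theta> * (\<theta> / A * \<bar>v x\<bar> powr p + (1 - \<theta>))" for x
  proof (cases "v x = 0")
    case True
    then show ?thesis using \<theta> A by simp
  next
    case False
    have "(\<bar>v x\<bar> powr p / A) powr \<theta> * 1 powr (1 - \<theta>) \<le> \<theta> * (\<bar>v x\<bar> powr p / A) + (1 - \<theta>) * 1"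
      using \<theta> A False by (intro Youngs_inequality_0) auto
    moreover have "(\<bar>v x\<bar> powr p / A) powr \<theta> = \<bar>v x\<bar> powr q / A powr \<theta>"
      using A pq by (simp add: powr_divide powr_powr \<theta>_def)
    ultimately show ?thesis using A by (simp add: field_simps)
  qed
  then have "(\<integral>x. \<bar>v x\<bar> powr q \<partial>lebesgue_on \<Omega>)
     \<le> (\<integral>x. A powr \<theta> * (\<theta> / A * \<bar>v x\<bar> powr p + (1 - \<theta>)) \<partial>lebesgue_on \<Omega>)"
    using pq integrable_powr[OF K, of p] integrable_powr[OF K, of q] by (intro integral_mono) auto
  also have "\<dots> = A powr \<theta> * (\<theta> / A * (A * measure lebesgue \<Omega>) + (1 - \<theta>) * measure lebesgue \<Omega>)"
    using integrable_powr[OF K, of p] pq measure_pos measure_space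
    by (simp add: A_def mean_power_def)
  also have "\<dots> = A powr \<theta> * measure lebesgue \<Omega>"
    using A by (simp add: algebra_simps)
  finally have "mean_power q \<le> A powr \<theta>"
    using measure_pos by (simp add: mean_power_def field_simps)
  then have "mean_power q powr (1 / q) \<le> (A powr \<theta>) powr (1 / q)"
    using pq by (intro powr_mono2) (auto simp: mean_power_nonneg)
  also have "\<dots> = A powr (1 / p)" using pq by (simp add: powr_powr \<theta>_def)
  finally show ?thesis by (simp add: mean_norm_real A_def)
qed

text \<open>\<open>\<bar>v\<bar>\<^sup>p \<le> K\<^sup>p\<^sup>-\<^sup>q \<bar>v\<bar>\<^sup>q\<close> bounds the mean power of order q from below by a continuous function of q.\<close>
private lemma mean_norm_real_left_continuous:
  assumes K: "AE x in lebesgue_on \<Omega>. \<bar>v x\<bar> \<le> K" "K > 0" and p: "p > 0"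
  shows "((\<lambda>q. mean_norm (ereal q) \<Omega> v) \<longlongrightarrow> mean_norm (ereal p) \<Omega> v) (at_left p)"
proof -
  have ev: "\<forall>\<^sub>F q in at_left p. 0 < q \<and> q < p"
    using p by (auto simp: eventually_at_left_field intro!: exI[of _ 0])
  show ?thesis
  proof (rule tendsto_sandwich)
    show "\<forall>\<^sub>F q in at_left p. (mean_power p * K powr (q - p)) powr (1 / q) \<le> mean_norm (ereal q) \<Omega> v"
      using ev
    proof eventually_elim
      case (elim q)
      have "(\<integral>x. K powr (q - p) * \<bar>v x\<bar> powr p \<partial>lebesgue_on \<Omega>) \<le> (\<integral>x. \<bar>v x\<bar> powr q \<partial>lebesgue_on \<Omega>)"
      proof (rule integral_mono_AE)
        show "AE x in lebesgue_on \<Omega>. K powr (q - p) * \<bar>v x\<bar> powr p \<le> \<bar>v x\<bar> powr q"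
          using K(1)
        proof eventually_elim
          fix x assume x: "\<bar>v x\<bar> \<le> K"
          have "K powr (q - p) * \<bar>v x\<bar> powr p = K powr (q - p) * (\<bar>v x\<bar> powr (p - q) * \<bar>v x\<bar> powr q)"
            by (simp add: powr_add[symmetric])
          also have "\<dots> \<le> K powr (q - p) * (K powr (p - q) * \<bar>v x\<bar> powr q)"
            using x elim by (intro mult_left_mono mult_right_mono powr_mono2) auto
          also have "\<dots> = \<bar>v x\<bar> powr q"
            using K(2) by (simp add: mult.assoc[symmetric] powr_add[symmetric])
          finally show "K powr (q - p) * \<bar>v x\<bar> powr p \<le> \<bar>v x\<bar> powr q" .
        qed
      qed (use integrable_powr[OF K(1)] elim p in auto)
      then have "mean_power p * K powr (q - p) \<le> mean_power q"
        using measure_pos by (simp add: mean_power_def divide_right_mono mult.commute)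
      then show ?case
        unfolding mean_norm_real using elim mean_power_nonneg[of p] by (intro powr_mono2) auto
    qed
    show "\<forall>\<^sub>F q in at_left p. mean_norm (ereal q) \<Omega> v \<le> mean_norm (ereal p) \<Omega> v"
      using ev by eventually_elim (use mean_norm_real_mono[OF K(1)] in auto)
    show "((\<lambda>q. (mean_power p * K powr (q - p)) powr (1 / q)) \<longlongrightarrow> mean_norm (ereal p) \<Omega> v) (at_left p)"
    \<comment> \<open>With mean 0 the lower bound is identically 0; otherwise the base stays
      positive and the power is continuous.\<close>
    proof (cases "mean_power p = 0")
      case True
      then show ?thesis by (simp add: mean_norm_real)
    next
      case False
      have "((\<lambda>q. (mean_power p * K powr (q - p)) powr (1 / q))
          \<longlongrightarrow> (mean_power p * K powr (p - p)) powr (1 / p)) (at_left p)"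
        using False K(2) p by (intro tendsto_intros) auto
      then show ?thesis using K(2) by (simp add: mean_norm_real)
    qed
  qed simp
qed

text \<open>\<open>Linf_norm\<close> passes through \<open>real_of_ereal\<close>, which would send
  an infinite essential supremum to 0. Finiteness comes from K, and the norm is then characterised
  as the least nonnegative essential bound on \<Omega>.\<close>

private lemma mean_norm_infinity:
  assumes K: "AE x in lebesgue_on \<Omega>. \<bar>v x\<bar> \<le> K" "K \<ge> 0"
  shows "0 \<le> mean_norm \<infinity> \<Omega> v" "mean_norm \<infinity> \<Omega> v \<le> K"
    "AE x in lebesgue_on \<Omega>. \<bar>v x\<bar> \<le> mean_norm \<infinity> \<Omega> v"
    "\<And>a. AE x in lebesgue_on \<Omega>. \<bar>v x\<bar> \<le> a \<Longrightarrow> 0 \<le> a \<Longrightarrow> mean_norm \<infinity> \<Omega> v \<le> a"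
proof -
  define E where "E = esssup lebesgue (\<lambda>x. ereal (indicator \<Omega> x * \<bar>v x\<bar>))"
  have fm: "(\<lambda>x. ereal (indicator \<Omega> x * \<bar>v x\<bar>)) \<in> borel_measurable lebesgue"
    using M(1) vm by measurable
  have AE_on: "(AE x in lebesgue_on \<Omega>. \<bar>v x\<bar> \<le> a) \<longleftrightarrow> (AE x in lebesgue. x \<in> \<Omega> \<longrightarrow> \<bar>v x\<bar> \<le> a)" for a
    using M(1) by (simp add: AE_restrict_space_iff)
  have le: "E \<le> ereal a" if "AE x in lebesgue_on \<Omega>. \<bar>v x\<bar> \<le> a" "0 \<le> a" for a
    unfolding E_def
  proof (rule esssup_I[OF fm])
    show "AE x in lebesgue. ereal (indicator \<Omega> x * \<bar>v x\<bar>) \<le> ereal a"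
      using that(1) unfolding AE_on by eventually_elim (use that(2) in \<open>auto split: split_indicator\<close>)
  qed
  have AE_E: "AE x in lebesgue. ereal (indicator \<Omega> x * \<bar>v x\<bar>) \<le> E"
    unfolding E_def by (rule esssup_AE)
  \<comment> \<open>Comparison with the zero function, whose essential supremum is 0 because the
    whole space is not null.\<close>
  have E0: "0 \<le> E"
  proof -
    have "esssup (lebesgue :: 'a measure) (\<lambda>x. 0 :: ereal) = 0"
      by (rule esssup_const) (simp add: emeasure_lborel_UNIV)
    moreover have "esssup (lebesgue :: 'a measure) (\<lambda>x. 0 :: ereal) \<le> E"
      unfolding E_def by (rule esssup_mono) auto
    ultimately show ?thesis by simp
  qed
  have EL: "E = ereal (mean_norm \<infinity> \<Omega> v)"
    using E0 le[OF K] by (cases E) (auto simp: mean_norm_def Linf_norm_def E_def[symmetric])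
  show "0 \<le> mean_norm \<infinity> \<Omega> v" "mean_norm \<infinity> \<Omega> v \<le> K"
    "\<And>a. AE x in lebesgue_on \<Omega>. \<bar>v x\<bar> \<le> a \<Longrightarrow> 0 \<le> a \<Longrightarrow> mean_norm \<infinity> \<Omega> v \<le> a"
    using E0 le K unfolding EL by auto
  show "AE x in lebesgue_on \<Omega>. \<bar>v x\<bar> \<le> mean_norm \<infinity> \<Omega> v"
    unfolding AE_on using AE_E by eventually_elim (auto simp: EL)
qed

text \<open>From above, averages do not exceed the essential bound. From below, for b under the
  essential supremum the set where \<bar>v\<bar> > b occupies a fraction \<delta> > 0 of \<Omega>,
  so the mean norm of order q is at least b \<delta>^(1/q), which tends to b.\<close>

private lemma mean_norm_tendsto_infinity:
  assumes K: "AE x in lebesgue_on \<Omega>. \<bar>v x\<bar> \<le> K" "K \<ge> 0"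
  shows "((\<lambda>q. mean_norm (ereal q) \<Omega> v) \<longlongrightarrow> mean_norm \<infinity> \<Omega> v) at_top"
proof (rule order_tendstoI)
  interpret finite_measure "lebesgue_on \<Omega>" by (rule fin)
  note [measurable] = v_measurable_on
  note L = mean_norm_infinity[OF K]
  show "\<forall>\<^sub>F q in at_top. mean_norm (ereal q) \<Omega> v < a" if "mean_norm \<infinity> \<Omega> v < a" for a
    using eventually_gt_at_top[of 0]
    by eventually_elim (use mean_norm_real_le[OF L(3,1)] that in \<open>auto intro: le_less_trans\<close>)
  fix a assume a: "a < mean_norm \<infinity> \<Omega> v"
  show "\<forall>\<^sub>F q in at_top. a < mean_norm (ereal q) \<Omega> v"
  proof (cases "a < 0")
    case True
    then show ?thesis by (auto simp: mean_norm_real intro!: always_eventually less_le_trans[OF True])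
  next
    case False
    \<comment> \<open>Halfway between a and the limit; a \<ge> 0 makes it positive, so taking powers
      preserves \<bar>v\<bar> > b.\<close>
    define b where "b = (a + mean_norm \<infinity> \<Omega> v) / 2"
    have b: "a < b" "b < mean_norm \<infinity> \<Omega> v" "b > 0" using a False by (auto simp: b_def)
    define S where "S = {x\<in>space (lebesgue_on \<Omega>). \<bar>v x\<bar> > b}"
    have S[measurable]: "S \<in> sets (lebesgue_on \<Omega>)" unfolding S_def by measurable
    have S_sub: "S \<inter> \<Omega> = S" by (auto simp: S_def space_restrict_space)
    have "measure (lebesgue_on \<Omega>) S \<noteq> 0"
    proof
      assume "measure (lebesgue_on \<Omega>) S = 0"
      then have "AE x in lebesgue_on \<Omega>. \<not> \<bar>v x\<bar> > b"
        using S by (subst AE_iff_measurable[of S]) (auto simp: S_def emeasure_eq_measure)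
      then have "mean_norm \<infinity> \<Omega> v \<le> b"
        using b by (intro L(4)) (auto simp: not_less)
      then show False using b by simp
    qed
    then have d: "measure (lebesgue_on \<Omega>) S > 0" by (simp add: zero_less_measure_iff)
    define \<delta> where "\<delta> = measure (lebesgue_on \<Omega>) S / measure lebesgue \<Omega>"
    have \<delta>: "\<delta> > 0" using d measure_pos by (simp add: \<delta>_def)
    have "((\<lambda>q::real. b * \<delta> powr (1 / q)) \<longlongrightarrow> b * \<delta> powr 0) at_top"
      using \<delta> by (intro tendsto_intros tendsto_divide_0[OF tendsto_const] filterlim_ident filterlim_at_top_imp_at_infinity) auto
    then have "\<forall>\<^sub>F q in at_top. a < b * \<delta> powr (1 / q)"
      using b \<delta> by (intro order_tendstoD(1)) auto
    moreover have "\<forall>\<^sub>F q in at_top. b * \<delta> powr (1 / q) \<le> mean_norm (ereal q) \<Omega> v"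
      using eventually_gt_at_top[of 0]
    proof eventually_elim
      case (elim q)
      have "b powr q * measure (lebesgue_on \<Omega>) S = (\<integral>x. b powr q * indicator S x \<partial>lebesgue_on \<Omega>)"
        by (simp add: S_sub)
      also have "\<dots> \<le> (\<integral>x. \<bar>v x\<bar> powr q \<partial>lebesgue_on \<Omega>)"
      proof (rule integral_mono)
        show "b powr q * indicator S x \<le> \<bar>v x\<bar> powr q" for x
          using b elim by (auto simp: S_def split: split_indicator intro!: powr_mono2)
      qed (use integrable_powr[OF K(1) elim] in \<open>auto intro!: integrable_real_indicator simp: emeasure_eq_measure\<close>)
      finally have "b powr q * \<delta> \<le> mean_power q"
        using measure_pos by (simp add: \<delta>_def mean_power_def divide_right_mono)
      then have "(b powr q * \<delta>) powr (1 / q) \<le> mean_power q powr (1 / q)"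
        using elim b \<delta> by (intro powr_mono2) auto
      then show ?case using elim b \<delta> by (simp add: mean_norm_real powr_mult powr_powr)
    qed
    ultimately show ?thesis by eventually_elim simp
  qed
qed

lemma mean_norm_bounds:
  assumes "AE x in lebesgue_on \<Omega>. \<bar>v x\<bar> \<le> K" "K \<ge> 0" "0 < p"
  shows "0 \<le> mean_norm p \<Omega> v" "mean_norm p \<Omega> v \<le> K"
  using assms mean_norm_infinity[OF assms(1,2)] mean_norm_real_le[OF assms(1,2)]
  by (cases p; simp add: mean_norm_real)+

lemma mean_norm_mono:
  assumes K: "AE x in lebesgue_on \<Omega>. \<bar>v x\<bar> \<le> K" "K \<ge> 0" and "0 < q" "q \<le> p"
  shows "mean_norm q \<Omega> v \<le> mean_norm p \<Omega> v"
  using assms mean_norm_real_mono[OF K(1)] mean_norm_real_le[OF mean_norm_infinity(3,1)[OF K]]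
  by (cases q; cases p) auto

text \<open>In the extended reals \<open>at_left\<close> is the image of the real left filter at a
  finite point and of \<open>at_top\<close> at \<infinity>, so the two real limits combine into one
  statement.\<close>

lemma mean_norm_left_continuous:
  assumes K: "AE x in lebesgue_on \<Omega>. \<bar>v x\<bar> \<le> K" "K > 0" and p: "0 < p"
  shows "((\<lambda>q. mean_norm q \<Omega> v) \<longlongrightarrow> mean_norm p \<Omega> v) (at_left p)"
proof (cases p)
  case (real r)
  have "((\<lambda>q. mean_norm (ereal q) \<Omega> v) \<longlongrightarrow> mean_norm (ereal r) \<Omega> v) (at_left r)"
    using p real by (intro mean_norm_real_left_continuous[OF K]) auto
  then show ?thesis
    by (simp add: real at_left_ereal filterlim_filtermap)
next
  case PInf
  have "((\<lambda>q. mean_norm (ereal q) \<Omega> v) \<longlongrightarrow> mean_norm \<infinity> \<Omega> v) at_top"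
    using K by (intro mean_norm_tendsto_infinity[OF K(1)]) auto
  then show ?thesis
    by (simp add: PInf at_left_PInf filterlim_filtermap)
qed (use p in auto)

end

section \<open>Left-continuity of the suprema\<close>

text \<open>Existence is what lets the choice operator deliver a function with the defining
  property.\<close>

lemma torsion_weak_solution:
  fixes \<Omega> :: "'a::euclidean_space set"
  assumes M: "\<Omega> \<in> sets lebesgue" "0 < emeasure lebesgue \<Omega>" "emeasure lebesgue \<Omega> < \<infinity>"
  obtains G where "H01 \<Omega> (torsion \<Omega>) G" "\<And>\<phi>. test_fun \<Omega> \<phi> \<Longrightarrow>
    (\<integral>x. G x \<bullet> grad \<phi> x \<partial>lebesgue_on \<Omega>) = (\<integral>x. \<phi> x \<partial>lebesgue_on \<Omega>)"
proof -
  let ?P = "\<lambda>v. \<exists>G. H01 \<Omega> v G \<and> (\<forall>\<phi>. test_fun \<Omega> \<phi> \<longrightarrow>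
      (\<integral>x. G x \<bullet> grad \<phi> x \<partial>lebesgue_on \<Omega>) = (\<integral>x. \<phi> x \<partial>lebesgue_on \<Omega>))"
  have "\<exists>v. ?P v" using weak_solution_exists[OF M] .
  then have "?P (SOME v. ?P v)" by (rule someI_ex)
  moreover have "torsion \<Omega> = (SOME v. ?P v)"
    unfolding torsion_def set_integral_eq_lebesgue_on[OF M(1)] ..
  ultimately show ?thesis using that by auto
qed

text \<open>If no competitor were available, \<open>lambda1\<close> would be the unspecified value \<open>Inf {}\<close>.\<close>
lemma lambda1_nonneg_or_null:
  fixes \<Omega> :: "'a::euclidean_space set"
  assumes H: "H01 \<Omega> u G" and M: "\<Omega> \<in> sets lebesgue" "emeasure lebesgue \<Omega> < \<infinity>"
  shows "0 \<le> lambda1 \<Omega> \<or> (AE x in lebesgue_on \<Omega>. u x = 0)"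
proof (cases "\<exists>u G. H01 \<Omega> u G \<and> (LINT x:\<Omega>|lebesgue. (u x)\<^sup>2) \<noteq> 0")
  case True
  have "0 \<le> lambda1 \<Omega>"
    unfolding lambda1_def
  proof (rule cInf_greatest)
    fix y assume "y \<in> {(LINT x:\<Omega>|lebesgue. (norm (G x))\<^sup>2) / (LINT x:\<Omega>|lebesgue. (u x)\<^sup>2) | u G.
      H01 \<Omega> u G \<and> (LINT x:\<Omega>|lebesgue. (u x)\<^sup>2) \<noteq> 0}"
    then show "0 \<le> y"
      by (auto simp: set_integral_eq_lebesgue_on[OF M(1)])
  qed (use True in auto)
  then show ?thesis ..
next
  case False
  then have "(\<integral>x. (u x)\<^sup>2 \<partial>lebesgue_on \<Omega>) = 0"
    using H set_integral_eq_lebesgue_on[OF M(1), of "\<lambda>x. (u x)\<^sup>2"] by auto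
  moreover have "integrable (lebesgue_on \<Omega>) (\<lambda>x. (u x)\<^sup>2)"
    using H01_approx[OF H M] by metis
  ultimately have "AE x in lebesgue_on \<Omega>. (u x)\<^sup>2 = 0"
    by (subst (asm) integral_nonneg_eq_0_iff_AE) auto
  then show ?thesis by auto
qed

lemma Ffun_mono_left_continuous:
  fixes \<Omega> :: "'a::euclidean_space set"
  assumes M: "open \<Omega>" "0 < emeasure lebesgue \<Omega>" "emeasure lebesgue \<Omega> < \<infinity>" and p: "0 < p"
  shows "0 < q \<Longrightarrow> q \<le> p \<Longrightarrow> Ffun q \<Omega> \<le> Ffun p \<Omega>"
    and "((\<lambda>q. Ffun q \<Omega>) \<longlongrightarrow> Ffun p \<Omega>) (at_left p)"
proof -
  define v where "v = torsion \<Omega>"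
  have L: "\<Omega> \<in> sets lebesgue" using M(1) by (simp add: borel_open)
  obtain G where H: "H01 \<Omega> v G" and weak: "\<And>\<phi>. test_fun \<Omega> \<phi> \<Longrightarrow>
    (\<integral>x. G x \<bullet> grad \<phi> x \<partial>lebesgue_on \<Omega>) = (\<integral>x. \<phi> x \<partial>lebesgue_on \<Omega>)"
    using torsion_weak_solution[OF L M(2,3)] unfolding v_def by blast
  have vm: "v \<in> borel_measurable lebesgue" using H by (simp add: H01_def)
  obtain K0 where "AE x in lebesgue_on \<Omega>. \<bar>v x\<bar> \<le> K0"
    using weak_solution_bounded[OF H L M(3) weak] by blast
  \<comment> \<open>A positive bound is wanted because powers of K with negative exponent occur in
    the left-continuity argument.\<close>
  then have "AE x in lebesgue_on \<Omega>. \<bar>v x\<bar> \<le> max 1 K0" by eventually_elim simp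
  then obtain K where K: "AE x in lebesgue_on \<Omega>. \<bar>v x\<bar> \<le> K" "K > 0"
    by (rule that[of "max 1 K0"]) simp
  note mono = mean_norm_mono[OF L M(2,3) vm K(1) less_imp_le[OF K(2)]]
  show "Ffun q \<Omega> \<le> Ffun p \<Omega>" if q: "0 < q" "q \<le> p"
  proof (cases "0 \<le> lambda1 \<Omega>")
    case True
    then show ?thesis
      unfolding Ffun_eq_mean_norm v_def[symmetric] by (intro mult_right_mono mono q)
  next
    \<comment> \<open>A negative \<open>lambda1\<close> would reverse the inequality, but then v is
      null and both sides are 0.\<close>
    case False
    then have "AE x in lebesgue_on \<Omega>. \<bar>v x\<bar> \<le> 0"
      using lambda1_nonneg_or_null[OF H L M(3)] by auto
    then have "mean_norm r \<Omega> v = 0" if "0 < r" for r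
      using mean_norm_bounds[OF L M(2,3) vm _ order_refl that] by (simp add: order_antisym)
    then show ?thesis
      using p q by (simp add: Ffun_eq_mean_norm v_def[symmetric])
  qed
  show "((\<lambda>q. Ffun q \<Omega>) \<longlongrightarrow> Ffun p \<Omega>) (at_left p)"
    unfolding Ffun_eq_mean_norm v_def[symmetric]
    by (intro tendsto_intros mean_norm_left_continuous[OF L M(2,3) vm K p])
qed

text \<open>Below the supremum, one nearly optimal x and its own left-continuity suffice. Above it,
  monotonicity keeps every supremum with q < p under the one at p, uniformly in x. The order
  formulation also covers an infinite supremum.\<close>

lemma SUP_left_continuous:
  fixes F :: "ereal \<Rightarrow> 'b \<Rightarrow> real"
  assumes mono: "\<And>x q p. x \<in> S \<Longrightarrow> c < q \<Longrightarrow> q \<le> p \<Longrightarrow> F q x \<le> F p x"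
    and lim: "\<And>x. x \<in> S \<Longrightarrow> ((\<lambda>q. F q x) \<longlongrightarrow> F p x) (at_left p)" and p: "c < p"
  shows "((\<lambda>q. SUP x\<in>S. ereal (F q x)) \<longlongrightarrow> (SUP x\<in>S. ereal (F p x))) (at_left p)"
proof (rule order_tendstoI)
  fix a assume "a < (SUP x\<in>S. ereal (F p x))"
  then obtain x where x: "x \<in> S" "a < ereal (F p x)" by (auto simp: less_SUP_iff)
  have "((\<lambda>q. ereal (F q x)) \<longlongrightarrow> ereal (F p x)) (at_left p)"
    using lim[OF x(1)] by (rule tendsto_ereal)
  then have "\<forall>\<^sub>F q in at_left p. a < ereal (F q x)"
    using x(2) by (rule order_tendstoD)
  then show "\<forall>\<^sub>F q in at_left p. a < (SUP x\<in>S. ereal (F q x))"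
    by eventually_elim (use x(1) in \<open>auto simp: less_SUP_iff\<close>)
next
  fix a assume a: "(SUP x\<in>S. ereal (F p x)) < a"
  have "\<forall>\<^sub>F q in at_left p. c < q \<and> q < p"
    using p by (auto simp: eventually_at_left[OF p])
  then show "\<forall>\<^sub>F q in at_left p. (SUP x\<in>S. ereal (F q x)) < a"
  proof eventually_elim
    case (elim q)
    have "(SUP x\<in>S. ereal (F q x)) \<le> (SUP x\<in>S. ereal (F p x))"
      using elim mono[of _ q p] by (intro SUP_mono) force
    then show ?case using a by (rule le_less_trans)
  qed
qed

theorem theorem3:
  assumes "DIM('a::euclidean_space) \<ge> 2"
  shows "(\<forall>p::ereal. 1 < p \<longrightarrow>
           ((Frak TYPE('a) \<longlongrightarrow> Frak TYPE('a) p) (at_left p) \<and>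
            (Frak_convex TYPE('a) \<longlongrightarrow> Frak_convex TYPE('a) p) (at_left p))) \<and>
         ((\<lambda>q::real. Frak TYPE('a) (ereal q)) \<longlongrightarrow> Frak TYPE('a) \<infinity>) at_top"
proof -
  have left: "(Frak TYPE('a) \<longlongrightarrow> Frak TYPE('a) p) (at_left p)"
    "(Frak_convex TYPE('a) \<longlongrightarrow> Frak_convex TYPE('a) p) (at_left p)" if p: "1 < p" for p
  proof -
    have pos: "0 < q" if "1 < q" for q :: ereal
      using that by (rule less_trans[rotated]) simp
    show "(Frak TYPE('a) \<longlongrightarrow> Frak TYPE('a) p) (at_left p)"
      unfolding Frak_def using p pos
      by (intro SUP_left_continuous[where c = 1] Ffun_mono_left_continuous) (auto intro: less_le_trans)
    show "(Frak_convex TYPE('a) \<longlongrightarrow> Frak_convex TYPE('a) p) (at_left p)"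
      unfolding Frak_convex_def using p pos
      by (intro SUP_left_continuous[where c = 1] Ffun_mono_left_continuous) (auto intro: less_le_trans)
  qed
  \<comment> \<open>The limit along real exponents is left-continuity at \<infinity>, read through
    the embedding of the reals.\<close>
  have "(Frak TYPE('a) \<longlongrightarrow> Frak TYPE('a) \<infinity>) (at_left \<infinity>)"
    by (rule left(1)) simp
  then have "((\<lambda>q::real. Frak TYPE('a) (ereal q)) \<longlongrightarrow> Frak TYPE('a) \<infinity>) at_top"
    by (simp add: at_left_PInf filterlim_filtermap)
  then show ?thesis using left by blast
qed

end
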